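(* Let $(S,X,T)\sim P_{S,X,T}$ be discrete random variables, and for $r\ge 0$ let $$g^{r}_{0}(P_{S,X,T})=\sup_{P_{Y\mid S,X,T}:\ I(Y;S)=0,\ I(X;Y)\leq r} I(Y;T).$$ Define $$U_0=H(T)+\sum_{t\in\mathcal{T}}\int_{0}^{1} \mathbb{P}_S\{P_{T\mid S}(t\mid S)\geq m\}\,\log\big(\mathbb{P}_S\{P_{T\mid S}(t\mid S)\geq m\}\big)\,dm .$$ (a) For every $0\leq r\leq H(X\mid S)$, $$\max\{L_1^{r},L_2,L_3^{r}\}\leq g^{r}_{0}(P_{S,X,T})\leq \min\{H(T\mid X)+r,\ H(T\mid S),\ U_0\},$$ where, with $\alpha=\frac{r}{H(X\mid S)}$, $L_1^{r} = H(T\mid X,S)+r-H(X,S\mid T)$, $L_2 = H(T\mid X,S)-\big(\log(I(X,S;T)+5.51)+1.06\big)$, $L_3^{r} = H(T\mid X,S)+r-\alpha H(X,S\mid T)-1.06-\log\big((1-\alpha)I(X,S;T)+\alpha\min\{H(T),H(X,S)\}+5.51\big)$. (b) For every $H(X\mid S)\leq r< H(X)$, $$\max\{{L'}_1^{r},L_2\}\leq g^{r}_{0}(P_{S,X,T})\leq \min\{H(T\mid X)+r,\ H(T\mid S),\ U_0\},$$ where ${L'}_1^{r}=H(T\mid S)-H(S\mid T)=H(T)-H(S)$.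
   Context: $S$ (sensitive attribute) takes values in a finite alphabet $\mathcal{S}$; $X$ (useful data) and $T$ (task) take values in finite or countably infinite alphabets $\mathcal{X},\mathcal{T}$, with finite entropies. The supremum is over all conditional distributions $P_{Y\mid S,X,T}$ of a discrete random variable $Y$ (the representation) given $(S,X,T)$. $\mathbb{P}_S$ denotes probability with respect to $S\sim P_S$, and $P_{T\mid S}(t\mid S)$ is the conditional pmf of $T$ evaluated at the random $S$. Logarithms are base 2. *)

theory Defs
  imports "HOL-Analysis.Analysis" "HOL-Probability.Probability_Mass_Function"
begin

definition ent :: "'a pmf \<Rightarrow> real" where
  "ent p = (\<Sum>\<^sub>\<infinity>x. - pmf p x * log 2 (pmf p x))"

definition finite_ent :: "'a pmf \<Rightarrow> bool" where
  "finite_ent p \<longleftrightarrow> (\<lambda>x. - pmf p x * log 2 (pmf p x)) summable_on UNIV"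

definition cond_ent :: "('a \<times> 'b) pmf \<Rightarrow> real" where
  "cond_ent J = ent J - ent (map_pmf snd J)"

definition mut_info :: "('a \<times> 'b) pmf \<Rightarrow> real" where
  "mut_info J = (\<Sum>\<^sub>\<infinity>z. pmf J z *
      log 2 (pmf J z / (pmf (map_pmf fst J) (fst z) * pmf (map_pmf snd J) (snd z))))"

definition joint_Y :: "('s \<times> 'x \<times> 't) pmf \<Rightarrow> ('s \<times> 'x \<times> 't \<Rightarrow> nat pmf) \<Rightarrow> ('s \<times> 'x \<times> 't \<times> nat) pmf" where
  "joint_Y P K = bind_pmf P (\<lambda>w. map_pmf (\<lambda>y. (fst w, fst (snd w), snd (snd w), y)) (K w))"

definition g0 :: "('s \<times> 'x \<times> 't) pmf \<Rightarrow> real \<Rightarrow> real" where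
  "g0 P r = Sup {mut_info (map_pmf (\<lambda>(s,x,t,y). (y,t)) (joint_Y P K)) | K.
       mut_info (map_pmf (\<lambda>(s,x,t,y). (y,s)) (joint_Y P K)) = 0 \<and>
       mut_info (map_pmf (\<lambda>(s,x,t,y). (x,y)) (joint_Y P K)) \<le> r}"

definition condT :: "('s \<times> 'x \<times> 't) pmf \<Rightarrow> 's \<Rightarrow> 't \<Rightarrow> real" where
  "condT P s t = pmf (map_pmf (\<lambda>(s,x,t). (s,t)) P) (s,t) / pmf (map_pmf fst P) s"

definition U0 :: "('s \<times> 'x \<times> 't) pmf \<Rightarrow> real" where
  "U0 P = ent (map_pmf (\<lambda>(s,x,t). t) P) +
     (\<Sum>\<^sub>\<infinity>t. integral {0..1} (\<lambda>m::real.
        measure_pmf.prob (map_pmf fst P) {s. condT P s t \<ge> m} *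
        log 2 (measure_pmf.prob (map_pmf fst P) {s. condT P s t \<ge> m})))"

end

theory Submission
  imports Defs "HOL-Probability.Probability" "HOL-Real_Asymp.Real_Asymp"
begin

text \<open>
  Upper bounds.  The first two are the chain rule and the data processing inequality.  For \<open>U\<^sub>0\<close>, fix \<open>t\<close>:
  since \<open>Y\<close> is independent of \<open>S\<close>, the functions \<open>s \<mapsto> P(t | s, y)\<close> average over \<open>y\<close> to
  \<open>s \<mapsto> P(t | s)\<close>, and by convexity of \<open>x log x\<close> the average of \<open>P(t | y) log P(t | y)\<close> is largest
  when the mass is put on the level sets of \<open>P(t | s)\<close>.

  Lower bounds.  Sharing time between two representations (with the choice revealed by \<open>Y\<close>) interpolates
  the constraint and the value linearly, so three representations suffice.  Two of them are families of
  independent copies of \<open>T\<close> given \<open>S = s\<close>, respectively given \<open>(X, S) = w\<close>.  The third one is the strong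
  functional representation with constants \<open>5.51\<close> and \<open>1.06\<close>: exponential clocks \<open>e\<^sub>t\<close> race, the winner
  minimises \<open>e\<^sub>t / P(t | w)\<close>, and \<open>Y\<close> consists of the rounded clocks.  Infinite alphabets are truncated,
  which costs an arbitrarily small amount and is harmless for a supremum.
\<close>

section \<open>Expectations over discrete laws\<close>

lemma integrable_measure_pmf_iff_summable_on:
  fixes f :: "'a \<Rightarrow> real"
  shows "integrable (measure_pmf p) f \<longleftrightarrow> (\<lambda>x. pmf p x * f x) summable_on UNIV"
  by (subst summable_on_iff_abs_summable_on_real, subst abs_summable_equivalent,
      subst measure_pmf_eq_density, subst integrable_real_density)
    (auto simp: abs_summable_on_def)

lemma expectation_pmf_eq_infsum:
  fixes f :: "'a \<Rightarrow> real"
  shows "measure_pmf.expectation p f = (\<Sum>\<^sub>\<infinity>x. pmf p x * f x)"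
proof (cases "integrable (measure_pmf p) f")
  case True
  then show ?thesis
    unfolding pmf_expectation_eq_infsetsum
    by (intro infsetsum_infsum abs_summable_equivalent[THEN iffD1]
        summable_on_iff_abs_summable_on_real[THEN iffD1])
      (simp add: integrable_measure_pmf_iff_summable_on)
next
  case False
  then show ?thesis
    by (simp add: not_integrable_integral_eq infsum_not_exists integrable_measure_pmf_iff_summable_on)
qed

lemma has_sum_expectation_pmf:
  fixes f :: "'a \<Rightarrow> real"
  assumes "integrable (measure_pmf p) f"
  shows "((\<lambda>x. pmf p x * f x) has_sum measure_pmf.expectation p f) UNIV"
  using assms unfolding expectation_pmf_eq_infsum integrable_measure_pmf_iff_summable_on
  by (rule has_sum_infsum)

lemma expectation_pmf_tail_le:
  fixes f :: "'a \<Rightarrow> real"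
  assumes f_integrable: "integrable (measure_pmf p) f" and "0 < e"
  obtains G where "finite G" "measure_pmf.expectation p (\<lambda>x. if x \<in> G then 0 else \<bar>f x\<bar>) \<le> e"
proof -
  have abs_integrable: "integrable (measure_pmf p) (\<lambda>x. \<bar>f x\<bar>)"
    using f_integrable by simp
  obtain G where finite_G: "finite G"
    and approx: "dist (\<Sum>x\<in>G. pmf p x * \<bar>f x\<bar>) (measure_pmf.expectation p (\<lambda>x. \<bar>f x\<bar>)) \<le> e"
    using has_sum_finite_approximation[OF has_sum_expectation_pmf[OF abs_integrable] \<open>0 < e\<close>] by auto
  have truncated_integrable: "integrable (measure_pmf p) (\<lambda>x. if x \<in> G then \<bar>f x\<bar> else 0)"
    by (rule Bochner_Integration.integrable_bound[OF f_integrable]) auto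
  have "measure_pmf.expectation p (\<lambda>x. if x \<in> G then 0 else \<bar>f x\<bar>)
      = measure_pmf.expectation p (\<lambda>x. \<bar>f x\<bar> - (if x \<in> G then \<bar>f x\<bar> else 0))"
    by (intro Bochner_Integration.integral_cong) auto
  also have "\<dots> = measure_pmf.expectation p (\<lambda>x. \<bar>f x\<bar>) - (\<Sum>x\<in>G. pmf p x * \<bar>f x\<bar>)"
    using abs_integrable truncated_integrable
    by (simp add: integral_measure_pmf[OF finite_G, of p "\<lambda>x. if x \<in> G then \<bar>f x\<bar> else 0"] split: if_splits)
  also have "\<dots> \<le> e"
    using approx by (simp add: dist_real_def abs_le_iff)
  finally show ?thesis
    using that finite_G by blast
qed

lemma nn_integral_pmf_ratio_le:
  "(\<integral>\<^sup>+x. r x * ennreal (pmf q x / pmf p x) \<partial>measure_pmf p) \<le> (\<integral>\<^sup>+x. r x \<partial>measure_pmf q)"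
proof -
  have "ennreal (pmf p x) * (r x * ennreal (pmf q x / pmf p x)) \<le> ennreal (pmf q x) * r x" for x
  proof (cases "pmf p x = 0")
    case False
    have "ennreal (pmf p x) * ennreal (pmf q x / pmf p x) = ennreal (pmf q x)"
      using False by (simp flip: ennreal_mult')
    then show ?thesis
      by (simp add: mult_ac)
  qed simp
  then show ?thesis
    unfolding nn_integral_measure_pmf by (intro nn_integral_mono)
qed

lemma (in prob_space) expectation_le_log:
  assumes "1 < b" "0 < c"
    and f_integrable: "integrable M f" and x_bound: "integrable M x" "expectation x \<le> c"
    and f_le_log: "AE \<omega> in M. 0 < x \<omega> \<and> f \<omega> \<le> log b (x \<omega>)"
  shows "expectation f \<le> log b c"
proof -
  have "expectation f \<le> expectation (\<lambda>\<omega>. log b c + (x \<omega> / c - 1) / ln b)"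
  proof (rule integral_mono_AE)
    show "AE \<omega> in M. f \<omega> \<le> log b c + (x \<omega> / c - 1) / ln b"
      using f_le_log
    proof eventually_elim
      case (elim \<omega>)
      then have "log b (x \<omega> / c) \<le> (x \<omega> / c - 1) / ln b"
        unfolding log_def using \<open>0 < c\<close> \<open>1 < b\<close> by (intro divide_right_mono ln_le_minus_one) auto
      with elim \<open>0 < c\<close> show ?case
        by (simp add: log_divide)
    qed
  qed (use f_integrable x_bound in auto)
  also have "\<dots> = log b c + (expectation x / c - 1) / ln b"
    using x_bound by (simp add: prob_space)
  also have "\<dots> \<le> log b c"
    using x_bound \<open>0 < c\<close> \<open>1 < b\<close> by (simp add: divide_nonpos_pos)
  finally show ?thesis .
qed

lemma (in prob_space) AE_eq_1_if_expectation_log_eq_0: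
  assumes "1 < b" and x_bound: "integrable M x" "expectation x \<le> 1" "AE \<omega> in M. 0 < x \<omega>"
    and log_x: "integrable M (\<lambda>\<omega>. log b (x \<omega>))" "expectation (\<lambda>\<omega>. log b (x \<omega>)) = 0"
  shows "AE \<omega> in M. x \<omega> = 1"
proof -
  define gap where "gap \<omega> = x \<omega> - 1 - ln b * log b (x \<omega>)" for \<omega>
  have ln_eq: "ln b * log b y = ln y" for y
    using \<open>1 < b\<close> by (simp add: log_def)
  have gap_nonneg: "AE \<omega> in M. 0 \<le> gap \<omega>"
    using x_bound(3) by eventually_elim (simp add: gap_def ln_eq ln_le_minus_one)
  have gap_integrable: "integrable M gap"
    unfolding gap_def using x_bound log_x by simp
  have "expectation gap = expectation x - 1"
    unfolding gap_def using x_bound log_x by (simp add: prob_space)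
  with x_bound(2) integral_nonneg_AE[OF gap_nonneg] have "expectation gap = 0"
    by simp
  then have "AE \<omega> in M. gap \<omega> = 0"
    using integral_nonneg_eq_0_iff_AE[OF gap_integrable gap_nonneg] by simp
  then show ?thesis
    using x_bound(3) by eventually_elim (auto simp: gap_def ln_eq intro!: ln_eq_minus_one)
qed

section \<open>Entropy\<close>

lemma finite_ent_iff_integrable:
  "finite_ent p \<longleftrightarrow> integrable (measure_pmf p) (\<lambda>x. log 2 (pmf p x))"
  unfolding finite_ent_def
  using integrable_measure_pmf_iff_summable_on[of p "\<lambda>x. - log 2 (pmf p x)"] by simp

lemma ent_eq_expectation: "ent p = measure_pmf.expectation p (\<lambda>x. - log 2 (pmf p x))"
  unfolding ent_def expectation_pmf_eq_infsum by simp

lemma log_pmf_nonpos: "log 2 (pmf p x) \<le> 0"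
  using pmf_le_1[of p x] pmf_nonneg[of p x]
  by (cases "pmf p x = 0") (auto simp: log_def divide_nonpos_pos)

lemma ent_nonneg: "0 \<le> ent p"
  unfolding ent_eq_expectation by (intro integral_nonneg_AE) (simp add: log_pmf_nonpos)

lemma pmf_le_pmf_map: "pmf p x \<le> pmf (map_pmf f p) (f x)"
  unfolding pmf_map
  by (subst measure_pmf_single[symmetric], rule measure_pmf.finite_measure_mono) auto

lemma finite_ent_if_finite_support: "finite (set_pmf p) \<Longrightarrow> finite_ent p"
  unfolding finite_ent_iff_integrable by (rule integrable_measure_pmf_finite)

lemma finite_ent_map_iff:
  "finite_ent (map_pmf f p) \<longleftrightarrow> integrable (measure_pmf p) (\<lambda>x. log 2 (pmf (map_pmf f p) (f x)))"
  by (simp add: finite_ent_iff_integrable)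

lemma ent_map_eq_expectation:
  "ent (map_pmf f p) = measure_pmf.expectation p (\<lambda>x. - log 2 (pmf (map_pmf f p) (f x)))"
  by (simp add: ent_eq_expectation)

lemma log_pmf_le_log_pmf_map:
  "x \<in> set_pmf p \<Longrightarrow> log 2 (pmf p x) \<le> log 2 (pmf (map_pmf f p) (f x))"
  by (simp add: pmf_positive pmf_le_pmf_map)

lemma finite_ent_map:
  assumes "finite_ent p"
  shows "finite_ent (map_pmf f p)"
  unfolding finite_ent_map_iff
proof (rule Bochner_Integration.integrable_bound)
  show "integrable (measure_pmf p) (\<lambda>x. log 2 (pmf p x))"
    using assms by (simp add: finite_ent_iff_integrable)
  show "AE x in measure_pmf p. norm (log 2 (pmf (map_pmf f p) (f x))) \<le> norm (log 2 (pmf p x))"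
    by (auto intro!: AE_pmfI simp: log_pmf_nonpos log_pmf_le_log_pmf_map)
qed simp

lemma ent_map_le:
  assumes "finite_ent p"
  shows "ent (map_pmf f p) \<le> ent p"
  unfolding ent_map_eq_expectation[of f p] ent_eq_expectation[of p]
  using assms finite_ent_map[OF assms, of f]
  by (intro integral_mono_AE)
    (auto intro!: AE_pmfI simp: log_pmf_le_log_pmf_map finite_ent_map_iff finite_ent_iff_integrable)

lemma ent_map_inj:
  assumes "inj_on f (set_pmf p)"
  shows "ent (map_pmf f p) = ent p"
  unfolding ent_map_eq_expectation[of f p] ent_eq_expectation[of p]
  by (intro integral_cong_AE AE_pmfI) (simp_all add: pmf_map_inj[OF assms])

lemma cond_ent_swap:
  "cond_ent (map_pmf (\<lambda>\<omega>. (A \<omega>, B \<omega>)) P) + ent (map_pmf B P)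
    = cond_ent (map_pmf (\<lambda>\<omega>. (B \<omega>, A \<omega>)) P) + ent (map_pmf A P)"
  using ent_map_inj[of prod.swap "map_pmf (\<lambda>\<omega>. (A \<omega>, B \<omega>)) P"] by (simp add: cond_ent_def map_pmf_comp)

section \<open>Mutual information\<close>

definition marginal_product :: "('a \<times> 'b) pmf \<Rightarrow> ('a \<times> 'b) pmf" where
  "marginal_product J = pair_pmf (map_pmf fst J) (map_pmf snd J)"

definition info_density :: "('a \<times> 'b) pmf \<Rightarrow> 'a \<times> 'b \<Rightarrow> real" where
  "info_density J z = log 2 (pmf J z / pmf (marginal_product J) z)"

lemma pmf_marginal_product:
  "pmf (marginal_product J) z = pmf (map_pmf fst J) (fst z) * pmf (map_pmf snd J) (snd z)"
  by (cases z) (simp add: marginal_product_def pmf_pair)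

lemma set_pmf_marginal_product: "z \<in> set_pmf J \<Longrightarrow> z \<in> set_pmf (marginal_product J)"
  by (cases z) (auto simp: marginal_product_def intro: rev_image_eqI)

definition product_ratio :: "('a \<times> 'b) pmf \<Rightarrow> 'a \<times> 'b \<Rightarrow> real" where
  "product_ratio J z = pmf (marginal_product J) z / pmf J z"

lemma product_ratio_pos: "z \<in> set_pmf J \<Longrightarrow> 0 < product_ratio J z"
  by (simp add: product_ratio_def pmf_positive set_pmf_marginal_product)

lemma marginal_product_pair_pmf [simp]: "marginal_product (pair_pmf p q) = pair_pmf p q"
  by (simp add: marginal_product_def map_fst_pair_pmf map_snd_pair_pmf)

lemma mut_info_eq_expectation: "mut_info J = measure_pmf.expectation J (info_density J)"
  by (simp add: mut_info_def expectation_pmf_eq_infsum info_density_def pmf_marginal_product)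

lemma info_density_eq_minus_log: "info_density J z = - log 2 (product_ratio J z)"
  unfolding info_density_def product_ratio_def by (subst log_inverse[symmetric]) simp_all

lemma info_density_eq:
  assumes "z \<in> set_pmf J"
  shows "info_density J z
    = log 2 (pmf J z) - log 2 (pmf (map_pmf fst J) (fst z)) - log 2 (pmf (map_pmf snd J) (snd z))"
proof -
  have "0 < pmf J z" "0 < pmf (map_pmf fst J) (fst z)" "0 < pmf (map_pmf snd J) (snd z)"
    using assms by (simp_all add: pmf_positive)
  then show ?thesis
    by (simp add: info_density_def pmf_marginal_product log_divide log_mult)
qed

lemma
  shows integrable_product_ratio: "integrable (measure_pmf J) (product_ratio J)"
    and expectation_product_ratio_le: "measure_pmf.expectation J (product_ratio J) \<le> 1"
proof -
  have ratio_le: "(\<integral>\<^sup>+z. ennreal (product_ratio J z) \<partial>measure_pmf J) \<le> ennreal 1"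
    using nn_integral_pmf_ratio_le[of J "\<lambda>_. 1" "marginal_product J"] by (simp add: product_ratio_def)
  then show integrable: "integrable (measure_pmf J) (product_ratio J)"
    by (intro integrableI_nonneg) (auto simp: product_ratio_def intro: le_less_trans)
  show "measure_pmf.expectation J (product_ratio J) \<le> 1"
    using ratio_le by (subst (asm) nn_integral_eq_integral[OF integrable]) (auto simp: product_ratio_def)
qed

lemma integrable_info_density:
  assumes "finite_ent (map_pmf snd J)"
  shows "integrable (measure_pmf J) (info_density J)"
proof (rule Bochner_Integration.integrable_bound)
  let ?bound = "\<lambda>z. - log 2 (pmf (map_pmf snd J) (snd z)) + product_ratio J z / ln 2"
  show "integrable (measure_pmf J) ?bound"
    using assms integrable_product_ratio[of J]
    by (intro Bochner_Integration.integrable_add integrable_divide) (simp_all add: finite_ent_map_iff)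
  show "AE z in measure_pmf J. norm (info_density J z) \<le> norm (?bound z)"
  proof (rule AE_pmfI)
    fix z assume support: "z \<in> set_pmf J"
    have upper: "info_density J z \<le> - log 2 (pmf (map_pmf snd J) (snd z))"
      using info_density_eq[OF support] log_pmf_le_log_pmf_map[OF support, of fst] by simp
    have "0 < product_ratio J z"
      using support by (rule product_ratio_pos)
    then have "ln (product_ratio J z) / ln 2 \<le> product_ratio J z / ln 2"
      using ln_le_minus_one[of "product_ratio J z"] by (intro divide_right_mono) auto
    then have lower: "- info_density J z \<le> product_ratio J z / ln 2"
      unfolding info_density_eq_minus_log by (simp add: log_def)
    have "0 \<le> - log 2 (pmf (map_pmf snd J) (snd z))" "0 \<le> product_ratio J z / ln 2"
      by (simp_all add: log_pmf_nonpos product_ratio_def)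
    with upper lower show "norm (info_density J z) \<le> norm (?bound z)"
      unfolding real_norm_def by linarith
  qed
qed simp

text \<open>The Donsker-Varadhan principle, with equality for \<open>r\<close> the inverse of the product ratio.\<close>

lemma expectation_le_mut_info:
  fixes N :: "'n pmf" and Z :: "'n \<Rightarrow> 'a \<times> 'b" and r :: "'a \<times> 'b \<Rightarrow> real"
  defines "J \<equiv> map_pmf Z N"
  assumes finite_ent_snd: "finite_ent (map_pmf snd J)"
    and r_bound: "(\<integral>\<^sup>+z. ennreal (r z) \<partial>measure_pmf (marginal_product J)) \<le> 1"
    and f_integrable: "integrable (measure_pmf N) f"
    and f_le_log: "\<And>n. n \<in> set_pmf N \<Longrightarrow> 0 < r (Z n) \<and> f n \<le> log 2 (r (Z n))"
  shows "measure_pmf.expectation N f \<le> mut_info J"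
proof -
  have density_integrable: "integrable (measure_pmf N) (\<lambda>n. info_density J (Z n))"
    using integrable_info_density[OF finite_ent_snd] by (simp add: J_def)
  have tilted_le: "(\<integral>\<^sup>+n. ennreal (r (Z n) * product_ratio J (Z n)) \<partial>measure_pmf N) \<le> ennreal 1"
  proof -
    have "(\<integral>\<^sup>+n. ennreal (r (Z n) * product_ratio J (Z n)) \<partial>measure_pmf N)
        = (\<integral>\<^sup>+z. ennreal (r z) * ennreal (product_ratio J z) \<partial>measure_pmf J)"
      by (simp add: J_def ennreal_mult'' product_ratio_def flip: times_divide_eq_right)
    also have "\<dots> \<le> 1"
      unfolding product_ratio_def by (rule order.trans[OF nn_integral_pmf_ratio_le r_bound])
    finally show ?thesis
      by simp
  qed
  have ratio_pos: "0 < product_ratio J (Z n)" if "n \<in> set_pmf N" for n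
    using that by (intro product_ratio_pos) (simp add: J_def)
  have tilted_nonneg: "AE n in measure_pmf N. 0 \<le> r (Z n) * product_ratio J (Z n)"
    using f_le_log ratio_pos by (intro AE_pmfI) (simp add: less_imp_le)
  have tilted_integrable: "integrable (measure_pmf N) (\<lambda>n. r (Z n) * product_ratio J (Z n))"
    by (rule integrableI_nonneg[OF _ tilted_nonneg]) (use tilted_le in \<open>auto intro: le_less_trans\<close>)
  have "measure_pmf.expectation N (\<lambda>n. f n - info_density J (Z n)) \<le> log 2 1"
  proof (rule measure_pmf.expectation_le_log)
    show "measure_pmf.expectation N (\<lambda>n. r (Z n) * product_ratio J (Z n)) \<le> 1"
      using tilted_le nn_integral_eq_integral[OF tilted_integrable tilted_nonneg] by simp
    show "AE n in measure_pmf N. 0 < r (Z n) * product_ratio J (Z n)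
        \<and> f n - info_density J (Z n) \<le> log 2 (r (Z n) * product_ratio J (Z n))"
      using f_le_log ratio_pos by (intro AE_pmfI) (simp add: info_density_eq_minus_log log_mult_pos)
  qed (use f_integrable density_integrable tilted_integrable in auto)
  then show ?thesis
    using f_integrable density_integrable by (simp add: mut_info_eq_expectation J_def)
qed

lemma mut_info_nonneg:
  assumes "finite_ent (map_pmf snd J)"
  shows "0 \<le> mut_info J"
  using expectation_le_mut_info[of "\<lambda>z. z" J "\<lambda>_. 1" "\<lambda>_. 0"] assms by simp

lemma mut_info_map_snd_le:
  assumes finite_ent_snd: "finite_ent (map_pmf snd J)"
  shows "mut_info (map_pmf (apsnd h) J) \<le> mut_info J"
proof -
  let ?J' = "map_pmf (apsnd h) J"
  let ?r = "\<lambda>z. pmf ?J' (apsnd h z) / pmf (marginal_product ?J') (apsnd h z)"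
  have marginals: "map_pmf fst ?J' = map_pmf fst J" "map_pmf snd ?J' = map_pmf h (map_pmf snd J)"
    by (simp_all add: map_pmf_comp)
  then have product_map: "marginal_product ?J' = map_pmf (apsnd h) (marginal_product J)"
    by (simp add: marginal_product_def pair_map_pmf2)
  have "mut_info ?J' = measure_pmf.expectation J (\<lambda>z. info_density ?J' (apsnd h z))"
    by (simp add: mut_info_eq_expectation)
  also have "\<dots> \<le> mut_info (map_pmf (\<lambda>z. z) J)"
  proof (rule expectation_le_mut_info)
    have "(\<integral>\<^sup>+z. ennreal (?r z) \<partial>measure_pmf (marginal_product J))
        = (\<integral>\<^sup>+z. 1 * ennreal (pmf ?J' z / pmf (marginal_product ?J') z) \<partial>measure_pmf (marginal_product ?J'))"
      by (simp add: product_map)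
    also have "\<dots> \<le> (\<integral>\<^sup>+z. 1 \<partial>measure_pmf ?J')"
      by (rule nn_integral_pmf_ratio_le)
    finally show "(\<integral>\<^sup>+z. ennreal (?r z) \<partial>measure_pmf (marginal_product (map_pmf (\<lambda>z. z) J))) \<le> 1"
      by simp
    show "integrable (measure_pmf J) (\<lambda>z. info_density ?J' (apsnd h z))"
      using integrable_info_density[of ?J'] finite_ent_map[OF finite_ent_snd, of h] by (simp add: marginals)
    show "0 < ?r z \<and> info_density ?J' (apsnd h z) \<le> log 2 (?r z)" if "z \<in> set_pmf J" for z
    proof -
      have "apsnd h z \<in> set_pmf ?J'"
        using that by simp
      then have "0 < ?r z"
        by (intro divide_pos_pos pmf_positive set_pmf_marginal_product)
      then show ?thesis
        by (simp add: info_density_def)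
    qed
  qed (use finite_ent_snd in simp)
  finally show ?thesis
    by simp
qed

lemma mut_info_le_add_ent_diff:
  assumes finite_ent_snd: "finite_ent (map_pmf snd J)"
  shows "mut_info J \<le> mut_info (map_pmf (apsnd h) J) + (ent (map_pmf snd J) - ent (map_pmf h (map_pmf snd J)))"
proof -
  let ?J' = "map_pmf (apsnd h) J" and ?B = "map_pmf snd J"
  have snd_map: "map_pmf snd ?J' = map_pmf h ?B" and fst_map: "map_pmf fst ?J' = map_pmf fst J"
    by (simp_all add: map_pmf_comp)
  let ?bound = "\<lambda>z. info_density ?J' (apsnd h z) - log 2 (pmf ?B (snd z))
      + log 2 (pmf (map_pmf h ?B) (h (snd z)))"
  have finite_ent_h: "finite_ent (map_pmf h ?B)"
    by (rule finite_ent_map[OF finite_ent_snd])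
  have density_integrable: "integrable (measure_pmf J) (\<lambda>z. info_density ?J' (apsnd h z))"
    using integrable_info_density[of ?J'] finite_ent_h by (simp add: snd_map)
  have logs_integrable: "integrable (measure_pmf J) (\<lambda>z. log 2 (pmf ?B (snd z)))"
      "integrable (measure_pmf J) (\<lambda>z. log 2 (pmf (map_pmf h ?B) (h (snd z))))"
    using finite_ent_snd finite_ent_h by (simp_all add: finite_ent_iff_integrable)
  have "mut_info J \<le> measure_pmf.expectation J ?bound"
    unfolding mut_info_eq_expectation
  proof (rule integral_mono_AE)
    show "AE z in measure_pmf J. info_density J z \<le> ?bound z"
    proof (rule AE_pmfI)
      fix z assume support: "z \<in> set_pmf J"
      then have support_map: "apsnd h z \<in> set_pmf ?J'"
        by simp
      show "info_density J z \<le> ?bound z"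
        using info_density_eq[OF support] info_density_eq[OF support_map]
          log_pmf_le_log_pmf_map[OF support, of "apsnd h"]
        by (simp only: fst_map snd_map fst_apsnd snd_apsnd)
    qed
  qed (use integrable_info_density[OF finite_ent_snd] density_integrable logs_integrable in simp_all)
  also have "\<dots> = mut_info ?J' + (ent ?B - ent (map_pmf h ?B))"
    using density_integrable logs_integrable by (simp add: mut_info_eq_expectation ent_eq_expectation)
  finally show ?thesis .
qed

lemma
  assumes "finite_ent (map_pmf fst J)" "finite_ent (map_pmf snd J)"
  shows finite_ent_joint: "finite_ent J"
    and mut_info_eq_ent: "mut_info J = ent (map_pmf fst J) + ent (map_pmf snd J) - ent J"
proof -
  let ?logs = "\<lambda>z. info_density J z + log 2 (pmf (map_pmf fst J) (fst z)) + log 2 (pmf (map_pmf snd J) (snd z))"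
  have parts_integrable: "integrable (measure_pmf J) (\<lambda>z. log 2 (pmf (map_pmf fst J) (fst z)))"
    "integrable (measure_pmf J) (\<lambda>z. log 2 (pmf (map_pmf snd J) (snd z)))"
    "integrable (measure_pmf J) (info_density J)"
    using assms integrable_info_density by (simp_all add: finite_ent_map_iff)
  have logs_eq: "AE z in measure_pmf J. ?logs z = log 2 (pmf J z)"
    by (rule AE_pmfI) (simp add: info_density_eq)
  show "finite_ent J"
    unfolding finite_ent_iff_integrable
    by (subst integrable_cong_AE[symmetric, OF _ _ logs_eq]) (use parts_integrable in auto)
  have "measure_pmf.expectation J (\<lambda>z. log 2 (pmf J z)) = measure_pmf.expectation J ?logs"
    by (rule integral_cong_AE) (use logs_eq in auto)
  then show "mut_info J = ent (map_pmf fst J) + ent (map_pmf snd J) - ent J"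
    using parts_integrable by (simp add: mut_info_eq_expectation ent_eq_expectation)
qed

lemma mut_info_pair_pmf [simp]: "mut_info (pair_pmf p q) = 0"
proof -
  have "info_density (pair_pmf p q) = (\<lambda>_. 0)"
    by (simp add: fun_eq_iff info_density_def log_def)
  then show ?thesis
    by (simp add: mut_info_eq_expectation)
qed

lemma mut_info_eq_0_iff:
  assumes finite_ent_snd: "finite_ent (map_pmf snd J)"
  shows "mut_info J = 0 \<longleftrightarrow> J = marginal_product J"
proof
  assume "mut_info J = 0"
  then have "measure_pmf.expectation J (\<lambda>z. log 2 (product_ratio J z)) = 0"
    by (simp add: mut_info_eq_expectation info_density_eq_minus_log[abs_def])
  moreover have "integrable (measure_pmf J) (\<lambda>z. log 2 (product_ratio J z))"
    using integrable_info_density[OF finite_ent_snd] by (simp add: info_density_eq_minus_log[abs_def])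
  moreover have "AE z in measure_pmf J. 0 < product_ratio J z"
    by (intro AE_pmfI product_ratio_pos)
  ultimately have "AE z in measure_pmf J. product_ratio J z = 1"
    by (intro measure_pmf.AE_eq_1_if_expectation_log_eq_0[where b = 2]
        integrable_product_ratio expectation_product_ratio_le) auto
  then have "pmf (marginal_product J) z = pmf J z" if "z \<in> set_pmf J" for z
    using that by (force simp: AE_measure_pmf_iff product_ratio_def)
  then have "pmf J z \<le> pmf (marginal_product J) z" for z
    by (cases "z \<in> set_pmf J") (simp_all add: set_pmf_iff)
  then show "J = marginal_product J"
    using pmf_neq_exists_less[of "marginal_product J" J] by (metis not_less)
next
  assume "J = marginal_product J"
  then show "mut_info J = 0"
    by (metis marginal_product_def mut_info_pair_pmf)
qed

lemma mut_info_map: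
  assumes inj_product: "inj_on h (set_pmf (marginal_product J))"
    and product_map: "marginal_product (map_pmf h J) = map_pmf h (marginal_product J)"
  shows "mut_info (map_pmf h J) = mut_info J"
proof -
  have "inj_on h (set_pmf J)"
    using inj_product by (rule inj_on_subset) (auto intro: set_pmf_marginal_product)
  then have "info_density (map_pmf h J) (h z) = info_density J z" if "z \<in> set_pmf J" for z
    using that inj_product by (simp add: info_density_def product_map pmf_map_inj set_pmf_marginal_product)
  then show ?thesis
    unfolding mut_info_eq_expectation integral_map_pmf by (intro integral_cong_AE AE_pmfI) auto
qed

lemma mut_info_map_fst_inj:
  assumes "inj_on f (set_pmf (map_pmf fst J))"
  shows "mut_info (map_pmf (apfst f) J) = mut_info J"
proof (rule mut_info_map)
  show "marginal_product (map_pmf (apfst f) J) = map_pmf (apfst f) (marginal_product J)"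
    by (simp add: marginal_product_def map_pmf_comp flip: pair_map_pmf1)
  have "inj_on (map_prod f id) (set_pmf (map_pmf fst J) \<times> set_pmf (map_pmf snd J))"
    using assms by (rule map_prod_inj_on) simp
  then show "inj_on (apfst f) (set_pmf (marginal_product J))"
    by (simp add: marginal_product_def apfst_def)
qed

lemma mut_info_swap: "mut_info (map_pmf prod.swap J) = mut_info J"
proof (rule mut_info_map)
  show "marginal_product (map_pmf prod.swap J) = map_pmf prod.swap (marginal_product J)"
    unfolding marginal_product_def
    by (subst pair_commute_pmf) (simp add: map_pmf_comp prod.swap_def case_prod_unfold)
qed simp

section \<open>Conditional laws\<close>

definition cond_law :: "('a \<times> 'b) pmf \<Rightarrow> 'a \<Rightarrow> 'b pmf" where
  "cond_law J a = map_pmf snd (cond_pmf J (fst -` {a}))"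

lemma Pair_cond_law:
  assumes "a \<in> fst ` set_pmf J"
  shows "map_pmf (Pair a) (cond_law J a) = cond_pmf J (fst -` {a})"
proof -
  have "set_pmf J \<inter> fst -` {a} \<noteq> {}"
    using assms by auto
  then show ?thesis
    unfolding cond_law_def map_pmf_comp by (intro map_pmf_idI) auto
qed

lemma bind_Pair_cond_law: "bind_pmf (map_pmf fst J) (\<lambda>a. map_pmf (Pair a) (cond_law J a)) = J"
proof -
  have "bind_pmf (map_pmf fst J) (\<lambda>a. map_pmf (Pair a) (cond_law J a))
      = bind_pmf (map_pmf fst J) (\<lambda>a. cond_pmf J {z. fst z = a})"
    by (intro bind_pmf_cong refl) (simp only: Pair_cond_law set_map_pmf vimage_def singleton_iff)
  also have "\<dots> = J"
    by (rule bind_cond_pmf_cancel) (auto simp: vimage_def eq_commute)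
  finally show ?thesis .
qed

lemma bind_cond_law: "bind_pmf (map_pmf fst J) (cond_law J) = map_pmf snd J"
  using arg_cong[OF bind_Pair_cond_law[of J], of "map_pmf snd"] by (simp add: map_bind_pmf map_pmf_comp)

lemma pmf_cond_law:
  assumes "a \<in> fst ` set_pmf J"
  shows "pmf (cond_law J a) b = pmf J (a, b) / pmf (map_pmf fst J) a"
proof -
  have "set_pmf J \<inter> fst -` {a} \<noteq> {}"
    using assms by auto
  moreover have "pmf (cond_law J a) b = pmf (cond_pmf J (fst -` {a})) (a, b)"
    unfolding Pair_cond_law[OF assms, symmetric] by (rule pmf_map_inj'[symmetric]) (simp add: inj_on_def)
  ultimately show ?thesis
    by (simp add: pmf_cond pmf_map)
qed

lemma set_pmf_cond_law:
  assumes "a \<in> fst ` set_pmf J"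
  shows "set_pmf (cond_law J a) = {b. (a, b) \<in> set_pmf J}"
proof -
  have "set_pmf J \<inter> fst -` {a} \<noteq> {}"
    using assms by auto
  then show ?thesis
    by (force simp: cond_law_def)
qed

lemma cond_law_map:
  assumes "a \<in> fst ` set_pmf J"
  shows "cond_law (map_pmf (apsnd h) J) a = map_pmf h (cond_law J a)"
proof -
  have vimage: "apsnd h -` fst -` {a} = fst -` {a}"
    by auto
  moreover have "set_pmf J \<inter> fst -` {a} \<noteq> {}"
    using assms by auto
  ultimately have "cond_pmf (map_pmf (apsnd h) J) (fst -` {a}) = map_pmf (apsnd h) (cond_pmf J (fst -` {a}))"
    by (subst cond_map_pmf) simp_all
  then show ?thesis
    by (simp add: cond_law_def map_pmf_comp)
qed

lemma cond_law_pair_pmf: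
  assumes "a \<in> set_pmf p"
  shows "cond_law (pair_pmf p q) a = q"
  using assms
  by (intro pmf_eqI) (simp add: pmf_cond_law map_fst_pair_pmf pmf_pair set_pmf_not_empty pmf_eq_0_set_pmf)

section \<open>The level set bound\<close>

definition xlog :: "real \<Rightarrow> real" where
  "xlog x = x * log 2 x"

lemma xlog_0 [simp]: "xlog 0 = 0"
  by (simp add: xlog_def)

lemma xlog_nonpos: "0 \<le> x \<Longrightarrow> x \<le> 1 \<Longrightarrow> xlog x \<le> 0"
  by (cases "x = 0") (auto simp: xlog_def intro!: mult_nonneg_nonpos)

lemma convex_on_xlog: "convex_on {0..} xlog"
proof (rule convex_on_linorderI)
  fix t x y :: real
  assume t_bounds: "0 < t" "t < 1" and xy_bounds: "x \<in> {0..}" "y \<in> {0..}" "x < y"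
  show "xlog ((1 - t) *\<^sub>R x + t *\<^sub>R y) \<le> (1 - t) * xlog x + t * xlog y"
  proof (cases "x = 0")
    case True
    have "t * y * log 2 t \<le> 0"
      using t_bounds xy_bounds True by (intro mult_nonneg_nonpos) auto
    then show ?thesis
      using t_bounds xy_bounds True by (simp add: xlog_def log_mult algebra_simps)
  next
    case False
    have "convex_on {0<..} xlog"
    proof (rule f''_ge0_imp_convex)
      fix x :: real assume x_pos: "x \<in> {0<..}"
      show "DERIV xlog x :> log 2 x + 1 / ln 2"
        unfolding xlog_def[abs_def] log_def using x_pos
        by (auto intro!: derivative_eq_intros simp: field_simps)
      show "DERIV (\<lambda>x. log 2 x + 1 / ln 2) x :> 1 / (x * ln 2)"
        unfolding log_def using x_pos by (auto intro!: derivative_eq_intros simp: field_simps)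
      show "0 \<le> 1 / (x * ln 2)"
        using x_pos by simp
    qed simp
    from convex_onD[OF this, of t x y] t_bounds xy_bounds False show ?thesis
      by simp
  qed
qed simp

lemma convex_on_diff_mono:
  fixes F :: "real \<Rightarrow> real"
  assumes convex_F: "convex_on {0..} F" and "0 \<le> x" "x \<le> y" "0 \<le> h"
  shows "F (x + h) - F x \<le> F (y + h) - F y"
proof (cases "y + h = x")
  case True
  with assms have "h = 0" "y = x" by auto
  then show ?thesis by simp
next
  case False
  define t where "t = h / (y + h - x)"
  have t_props: "0 \<le> t" "t \<le> 1" "t * (y + h - x) = h"
    using False assms by (auto simp: t_def)
  have "F (x + h) \<le> (1 - t) * F x + t * F (y + h)"
    using convex_onD[OF convex_F, of t x "y + h"] t_props assms by (simp add: algebra_simps)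
  moreover have "F y \<le> t * F x + (1 - t) * F (y + h)"
    using convex_onD[OF convex_F, of "1 - t" x "y + h"] t_props assms by (simp add: algebra_simps)
  ultimately show ?thesis
    by (simp add: algebra_simps)
qed

lemma convex_on_weighted_sum_le:
  fixes F :: "real \<Rightarrow> real" and p f :: "nat \<Rightarrow> real"
  assumes convex_F: "convex_on {0..} F" and zero_F: "F 0 = 0"
    and p_nonneg: "\<And>i. i < n \<Longrightarrow> 0 \<le> p i" and f_bounds: "\<And>i. i < n \<Longrightarrow> 0 \<le> f i \<and> f i \<le> 1"
  shows "F (\<Sum>i<n. p i * f i) \<le> (\<Sum>i<n. f i * (F (\<Sum>j<Suc i. p j) - F (\<Sum>j<i. p j)))"
  using p_nonneg f_bounds
proof (induction n)
  case 0
  then show ?case by (simp add: zero_F)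
next
  case (Suc n)
  let ?weighted = "\<Sum>i<n. p i * f i" and ?total = "\<Sum>j<n. p j"
  have step_bounds: "0 \<le> p n" "0 \<le> f n" "f n \<le> 1"
    using Suc.prems by auto
  have weighted_bounds: "0 \<le> ?weighted" "?weighted \<le> ?total"
    using Suc.prems by (auto intro!: sum_nonneg sum_mono mult_left_le simp: less_Suc_eq)
  have "F (?weighted + p n * f n) - F ?weighted \<le> F (?total + p n * f n) - F ?total"
    by (rule convex_on_diff_mono[OF convex_F]) (use weighted_bounds step_bounds in auto)
  also have "F (?total + p n * f n) \<le> (1 - f n) * F ?total + f n * F (?total + p n)"
    using convex_onD[OF convex_F, of "f n" ?total "?total + p n"] weighted_bounds step_bounds
    by (simp add: algebra_simps)
  finally have "F (?weighted + p n * f n) - F ?weighted \<le> f n * (F (?total + p n) - F ?total)"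
    by (simp add: algebra_simps)
  moreover have "F ?weighted \<le> (\<Sum>i<n. f i * (F (\<Sum>j<Suc i. p j) - F (\<Sum>j<i. p j)))"
    using Suc by simp
  ultimately show ?case by simp
qed

lemma antitone_enumeration:
  fixes c :: "'s \<Rightarrow> real"
  assumes "finite A"
  obtains \<sigma> where "bij_betw \<sigma> {..<card A} A"
    "\<And>i j. i \<le> j \<Longrightarrow> j < card A \<Longrightarrow> c (\<sigma> j) \<le> c (\<sigma> i)"
proof -
  obtain xs where xs_enum: "set xs = A" "distinct xs"
    using finite_distinct_list[OF assms] by blast
  define ys where "ys = sort_key (\<lambda>s. - c s) xs"
  have ys_sorted: "set ys = A" "distinct ys" "sorted (map (\<lambda>s. - c s) ys)"
    using xs_enum by (simp_all add: ys_def)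
  then have length_ys: "length ys = card A"
    by (metis distinct_card)
  show ?thesis
  proof (rule that[of "\<lambda>i. ys ! i"])
    show "bij_betw ((!) ys) {..<card A} A"
      using ys_sorted length_ys by (intro bij_betw_nth) auto
    show "c (ys ! j) \<le> c (ys ! i)" if "i \<le> j" "j < card A" for i j
      using sorted_nth_mono[OF ys_sorted(3) that(1)] that length_ys by simp
  qed
qed

lemma antitone_level_set_eq_lessThan:
  fixes c :: "nat \<Rightarrow> 'a::linorder"
  assumes "\<And>i j. i \<le> j \<Longrightarrow> j < n \<Longrightarrow> c j \<le> c i"
  obtains k where "{i. i < n \<and> m \<le> c i} = {..<k}"
proof (cases "\<forall>i<n. m \<le> c i")
  case True
  with that[of n] show ?thesis by auto
next
  case False
  define k where "k = (LEAST i. i < n \<and> c i < m)"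
  have k_least: "k < n" "c k < m"
    unfolding k_def using False by (metis (mono_tags, lifting) LeastI not_le)+
  have below: "m \<le> c i" if "i < k" for i
    using not_less_Least[of i "\<lambda>i. i < n \<and> c i < m"] that k_least by (simp add: k_def[symmetric] not_less)
  have above: "c i < m" if "k \<le> i" "i < n" for i
    using assms[OF that] k_least by simp
  have "{i. i < n \<and> m \<le> c i} = {..<k}"
  proof (rule set_eqI)
    show "i \<in> {i. i < n \<and> m \<le> c i} \<longleftrightarrow> i \<in> {..<k}" for i
      using below[of i] above[of i] k_least by (cases "i < k") auto
  qed
  then show ?thesis by (rule that)
qed

lemma has_integral_indicator_atMost:
  fixes c :: real
  assumes "0 \<le> c" "c \<le> 1"
  shows "((\<lambda>m. indicator {..c} m * k) has_integral c * k) {0..1::real}"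
proof -
  have "((\<lambda>m. k) has_integral c * k) {0..c}"
    using has_integral_const_real[of k 0 c] assms by simp
  then have "((\<lambda>m. if m \<in> {0..c} then k else 0) has_integral c * k) {0..1}"
    by (subst has_integral_restrict) (use assms in auto)
  then show ?thesis
    by (rule has_integral_eq[rotated]) (auto simp: indicator_def)
qed

definition level_integral :: "(real \<Rightarrow> real) \<Rightarrow> 's pmf \<Rightarrow> ('s \<Rightarrow> real) \<Rightarrow> real" where
  "level_integral F p c = integral {0..1} (\<lambda>m. F (measure_pmf.prob p {s. m \<le> c s}))"

lemma level_integral_nonpos:
  assumes "\<And>x. 0 \<le> x \<Longrightarrow> x \<le> 1 \<Longrightarrow> F x \<le> 0"
  shows "level_integral F p c \<le> 0"
proof (cases "(\<lambda>m. F (measure_pmf.prob p {s. m \<le> c s})) integrable_on {0..1}")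
  case True
  then have "level_integral F p c \<le> integral {0..1::real} (\<lambda>_. 0)"
    unfolding level_integral_def by (intro integral_le integrable_0) (simp_all add: assms)
  then show ?thesis by simp
next
  case False
  then show ?thesis by (simp add: level_integral_def not_integrable_integral)
qed

lemma level_integral_eq_sum_increments:
  fixes p :: "'s pmf" and c :: "'s \<Rightarrow> real" and F :: "real \<Rightarrow> real"
  defines "n \<equiv> card (set_pmf p)"
  assumes zero_F: "F 0 = 0" and enumeration: "bij_betw \<sigma> {..<n} (set_pmf p)"
    and antitone: "\<And>i j. i \<le> j \<Longrightarrow> j < n \<Longrightarrow> c (\<sigma> j) \<le> c (\<sigma> i)"
    and c_bounds: "\<And>s. s \<in> set_pmf p \<Longrightarrow> 0 \<le> c s \<and> c s \<le> 1"
  shows "level_integral F p c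
    = (\<Sum>i<n. c (\<sigma> i) * (F (\<Sum>j<Suc i. pmf p (\<sigma> j)) - F (\<Sum>j<i. pmf p (\<sigma> j))))"
proof -
  define mass where "mass k = (\<Sum>j<k. pmf p (\<sigma> j))" for k
  have finite_support: "finite (set_pmf p)"
    using bij_betw_finite[OF enumeration] by simp
  have "F (measure_pmf.prob p {s. m \<le> c s})
      = (\<Sum>i<n. indicator {..c (\<sigma> i)} m * (F (mass (Suc i)) - F (mass i)))" for m
  proof -
    obtain k where level_set: "{i. i < n \<and> m \<le> c (\<sigma> i)} = {..<k}"
      using antitone by (rule antitone_level_set_eq_lessThan)
    have "{..<k} \<subseteq> {..<n}"
      unfolding level_set[symmetric] by blast
    with bij_betw_imp_inj_on[OF enumeration] have inj_level_set: "inj_on \<sigma> {..<k}"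
      by (rule inj_on_subset)
    have "measure_pmf.prob p {s. m \<le> c s} = (\<Sum>s\<in>{s. m \<le> c s} \<inter> set_pmf p. pmf p s)"
      using finite_support by (subst measure_Int_set_pmf[symmetric]) (simp add: measure_measure_pmf_finite)
    also have "{s. m \<le> c s} \<inter> set_pmf p = \<sigma> ` {..<k}"
      unfolding level_set[symmetric] bij_betw_imp_surj_on[OF enumeration, symmetric] by auto
    also have "(\<Sum>s\<in>\<sigma> ` {..<k}. pmf p s) = mass k"
      using inj_level_set by (simp add: mass_def sum.reindex)
    finally have "F (measure_pmf.prob p {s. m \<le> c s}) = (\<Sum>i<k. F (mass (Suc i)) - F (mass i))"
      using sum_lessThan_telescope[of "\<lambda>i. F (mass i)" k] by (simp add: zero_F mass_def)
    also have "\<dots> = (\<Sum>i<n. indicator {..c (\<sigma> i)} m * (F (mass (Suc i)) - F (mass i)))"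
      unfolding level_set[symmetric] by (intro sum.mono_neutral_cong_left) (auto simp: indicator_def)
    finally show ?thesis .
  qed
  then have "((\<lambda>m. F (measure_pmf.prob p {s. m \<le> c s})) has_integral
      (\<Sum>i<n. c (\<sigma> i) * (F (mass (Suc i)) - F (mass i)))) {0..1::real}"
    using c_bounds bij_betw_apply[OF enumeration]
    by (simp only:) (intro has_integral_sum has_integral_indicator_atMost, auto)
  then show ?thesis
    unfolding level_integral_def mass_def by (rule integral_unique)
qed

text \<open>The weights \<open>d\<close> are the increments of \<open>F\<close> along the cumulative masses of the level sets of \<open>c\<close>:
  a subgradient at \<open>c\<close> of the Lovasz extension of the supermodular set function \<open>A \<mapsto> F (p A)\<close>.\<close>

lemma level_integral_subgradient:
  fixes p :: "'s pmf" and c :: "'s \<Rightarrow> real" and F :: "real \<Rightarrow> real"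
  assumes finite_support: "finite (set_pmf p)" and convex_F: "convex_on {0..} F" "F 0 = 0"
    and c_bounds: "\<And>s. s \<in> set_pmf p \<Longrightarrow> 0 \<le> c s \<and> c s \<le> 1"
  obtains d where
    "\<And>f. \<forall>s\<in>set_pmf p. 0 \<le> f s \<and> f s \<le> 1 \<Longrightarrow>
      F (measure_pmf.expectation p f) \<le> (\<Sum>s\<in>set_pmf p. f s * d s)"
    "level_integral F p c = (\<Sum>s\<in>set_pmf p. c s * d s)"
proof -
  define n where "n = card (set_pmf p)"
  obtain \<sigma> where enumeration: "bij_betw \<sigma> {..<n} (set_pmf p)"
    and antitone: "\<And>i j. i \<le> j \<Longrightarrow> j < n \<Longrightarrow> c (\<sigma> j) \<le> c (\<sigma> i)"
    using antitone_enumeration[OF finite_support, of c] unfolding n_def by auto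
  define increment where
    "increment i = F (\<Sum>j<Suc i. pmf p (\<sigma> j)) - F (\<Sum>j<i. pmf p (\<sigma> j))" for i
  define d where "d s = increment (inv_into {..<n} \<sigma> s)" for s
  have reindex: "(\<Sum>s\<in>set_pmf p. h s * d s) = (\<Sum>i<n. h (\<sigma> i) * increment i)" for h
    unfolding sum.reindex_bij_betw[OF enumeration, symmetric]
    by (intro sum.cong refl) (simp add: d_def bij_betw_inv_into_left[OF enumeration])
  show ?thesis
  proof (rule that[of d])
    fix f :: "'s \<Rightarrow> real" assume f_bounds: "\<forall>s\<in>set_pmf p. 0 \<le> f s \<and> f s \<le> 1"
    have "measure_pmf.expectation p f = (\<Sum>s\<in>set_pmf p. pmf p s * f s)"
      using finite_support by (subst integral_measure_pmf_real[of "set_pmf p"]) (auto simp: mult.commute)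
    also have "\<dots> = (\<Sum>i<n. pmf p (\<sigma> i) * f (\<sigma> i))"
      by (rule sum.reindex_bij_betw[OF enumeration, symmetric])
    finally show "F (measure_pmf.expectation p f) \<le> (\<Sum>s\<in>set_pmf p. f s * d s)"
      unfolding reindex increment_def
      using convex_on_weighted_sum_le[OF convex_F, of n "\<lambda>i. pmf p (\<sigma> i)" "\<lambda>i. f (\<sigma> i)"]
        f_bounds bij_betw_apply[OF enumeration]
      by simp
  next
    show "level_integral F p c = (\<Sum>s\<in>set_pmf p. c s * d s)"
      unfolding reindex increment_def n_def
      by (rule level_integral_eq_sum_increments[where \<sigma> = \<sigma> and F = F])
        (use convex_F enumeration antitone c_bounds in \<open>simp_all add: n_def\<close>)
  qed
qed

lemma (in prob_space) expectation_convex_le_level_integral: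
  fixes p :: "'s pmf" and f :: "'a \<Rightarrow> 's \<Rightarrow> real" and F :: "real \<Rightarrow> real"
  assumes finite_support: "finite (set_pmf p)" and convex_F: "convex_on {0..} F" "F 0 = 0"
    and f_measurable [measurable]: "\<And>s. s \<in> set_pmf p \<Longrightarrow> (\<lambda>y. f y s) \<in> borel_measurable M"
    and f_bounds: "\<And>s. s \<in> set_pmf p \<Longrightarrow> AE y in M. 0 \<le> f y s \<and> f y s \<le> 1"
    and F_integrable: "integrable M (\<lambda>y. F (measure_pmf.expectation p (f y)))"
  shows "expectation (\<lambda>y. F (measure_pmf.expectation p (f y)))
    \<le> level_integral F p (\<lambda>s. expectation (\<lambda>y. f y s))"
proof -
  have f_integrable: "integrable M (\<lambda>y. f y s)" if "s \<in> set_pmf p" for s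
  proof (rule integrable_const_bound[where B = 1])
    show "AE y in M. norm (f y s) \<le> 1"
      using f_bounds[OF that] by eventually_elim simp
  qed (rule f_measurable[OF that])
  have mean_bounds: "0 \<le> expectation (\<lambda>y. f y s) \<and> expectation (\<lambda>y. f y s) \<le> 1" if "s \<in> set_pmf p" for s
    using f_bounds[OF that] f_integrable[OF that] by (simp add: integral_nonneg_AE integral_le_const)
  obtain d where subgradient: "\<And>g. \<forall>s\<in>set_pmf p. 0 \<le> g s \<and> g s \<le> 1 \<Longrightarrow>
      F (measure_pmf.expectation p g) \<le> (\<Sum>s\<in>set_pmf p. g s * d s)"
    and level: "level_integral F p (\<lambda>s. expectation (\<lambda>y. f y s)) = (\<Sum>s\<in>set_pmf p. expectation (\<lambda>y. f y s) * d s)"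
    by (rule level_integral_subgradient[OF finite_support convex_F, of "\<lambda>s. expectation (\<lambda>y. f y s)"])
      (use mean_bounds in blast)+
  have "AE y in M. \<forall>s\<in>set_pmf p. 0 \<le> f y s \<and> f y s \<le> 1"
    using f_bounds by (intro AE_finite_allI[OF finite_support])
  then have "AE y in M. F (measure_pmf.expectation p (f y)) \<le> (\<Sum>s\<in>set_pmf p. f y s * d s)"
    by eventually_elim (rule subgradient)
  then have "expectation (\<lambda>y. F (measure_pmf.expectation p (f y))) \<le> expectation (\<lambda>y. \<Sum>s\<in>set_pmf p. f y s * d s)"
    using F_integrable f_integrable by (intro integral_mono_AE) auto
  also have "\<dots> = level_integral F p (\<lambda>s. expectation (\<lambda>y. f y s))"
    using f_integrable by (simp add: level)
  finally show ?thesis .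
qed

lemma expectation_posterior_le_level_integral:
  fixes C :: "'y \<Rightarrow> ('s \<times> 't) pmf" and F :: "real \<Rightarrow> real"
  assumes finite_support: "finite (set_pmf p)" and convex_F: "convex_on {0..} F" "F 0 = 0"
    and prior: "\<And>y. y \<in> set_pmf Y \<Longrightarrow> map_pmf fst (C y) = p"
    and F_integrable: "integrable (measure_pmf Y) (\<lambda>y. F (pmf (map_pmf snd (C y)) t))"
  shows "measure_pmf.expectation Y (\<lambda>y. F (pmf (map_pmf snd (C y)) t))
    \<le> level_integral F p (\<lambda>s. pmf (bind_pmf Y C) (s, t) / pmf p s)"
proof -
  define f where "f y s = pmf (C y) (s, t) / pmf p s" for y s
  have f_bounds: "0 \<le> f y s \<and> f y s \<le> 1" if "y \<in> set_pmf Y" "s \<in> set_pmf p" for y s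
    using pmf_le_pmf_map[of "C y" "(s, t)" fst] pmf_positive[OF that(2)]
    by (simp add: f_def prior[OF that(1)] divide_le_eq_1)
  have posterior: "pmf (map_pmf snd (C y)) t = measure_pmf.expectation p (f y)" if support: "y \<in> set_pmf Y" for y
  proof -
    have "pmf (map_pmf snd (C y)) t = measure_pmf.prob (C y) (snd -` {t} \<inter> set_pmf (C y))"
      by (simp add: pmf_map measure_Int_set_pmf)
    also have "\<dots> = measure_pmf.prob (C y) ((\<lambda>s. (s, t)) ` set_pmf p \<inter> set_pmf (C y))"
      unfolding prior[OF support, symmetric]
      by (auto intro!: arg_cong[where f = "measure_pmf.prob _"] intro: rev_image_eqI)
    also have "\<dots> = (\<Sum>s\<in>set_pmf p. pmf (C y) (s, t))"
      using finite_support
      by (simp add: measure_Int_set_pmf measure_measure_pmf_finite sum.reindex inj_on_def)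
    also have "\<dots> = measure_pmf.expectation p (f y)"
      using finite_support by (subst integral_measure_pmf_real[of "set_pmf p"]) (auto simp: f_def set_pmf_iff)
    finally show ?thesis .
  qed
  have "integrable (measure_pmf Y) (\<lambda>y. F (pmf (map_pmf snd (C y)) t))
      \<longleftrightarrow> integrable (measure_pmf Y) (\<lambda>y. F (measure_pmf.expectation p (f y)))"
    by (intro integrable_cong_AE AE_pmfI) (simp_all add: posterior)
  with F_integrable have "measure_pmf.expectation Y (\<lambda>y. F (measure_pmf.expectation p (f y)))
      \<le> level_integral F p (\<lambda>s. measure_pmf.expectation Y (\<lambda>y. f y s))"
    using f_bounds
    by (intro measure_pmf.expectation_convex_le_level_integral[OF finite_support convex_F])
      (auto intro!: AE_pmfI)
  also have "(\<lambda>s. measure_pmf.expectation Y (\<lambda>y. f y s)) = (\<lambda>s. pmf (bind_pmf Y C) (s, t) / pmf p s)"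
    by (simp add: f_def pmf_bind)
  also have "measure_pmf.expectation Y (\<lambda>y. F (measure_pmf.expectation p (f y)))
      = measure_pmf.expectation Y (\<lambda>y. F (pmf (map_pmf snd (C y)) t))"
    by (intro integral_cong_AE AE_pmfI) (simp_all add: posterior)
  finally show ?thesis .
qed

lemma
  fixes J :: "('y \<times> 't) pmf"
  assumes finite_ent_snd: "finite_ent (map_pmf snd J)"
  shows integrable_xlog_cond_law:
      "integrable (measure_pmf (map_pmf fst J)) (\<lambda>y. xlog (pmf (cond_law J y) t))"
    and has_sum_expectation_xlog_cond_law:
      "((\<lambda>t. measure_pmf.expectation (map_pmf fst J) (\<lambda>y. xlog (pmf (cond_law J y) t)))
        has_sum (mut_info J - ent (map_pmf snd J))) UNIV"
proof -
  let ?Y = "map_pmf fst J" and ?T = "map_pmf snd J"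
  let ?log = "\<lambda>z. info_density J z + log 2 (pmf ?T (snd z))"
  have parts_integrable: "integrable (measure_pmf J) (info_density J)"
    "integrable (measure_pmf J) (\<lambda>z. log 2 (pmf ?T (snd z)))"
    using finite_ent_snd by (simp_all add: integrable_info_density finite_ent_map_iff)
  then have "((\<lambda>z. pmf J z * ?log z) has_sum measure_pmf.expectation J ?log) (UNIV \<times> UNIV)"
    unfolding UNIV_Times_UNIV by (intro has_sum_expectation_pmf) simp
  moreover have "pmf J (y, t) * ?log (y, t) = pmf ?Y y * xlog (pmf (cond_law J y) t)" for y t
  proof (cases "(y, t) \<in> set_pmf J")
    case True
    then have support: "y \<in> fst ` set_pmf J"
      by force
    have "0 < pmf J (y, t)" "0 < pmf ?Y y"
      using True support by (simp_all add: pmf_positive)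
    then show ?thesis
      using info_density_eq[OF True] by (simp add: xlog_def pmf_cond_law[OF support] log_divide)
  next
    case False
    then have pmf_zero: "pmf J (y, t) = 0"
      by (simp add: pmf_eq_0_set_pmf)
    then have "pmf ?Y y = 0 \<or> pmf (cond_law J y) t = 0"
      by (cases "y \<in> fst ` set_pmf J") (simp_all add: pmf_cond_law pmf_eq_0_set_pmf)
    with pmf_zero show ?thesis by auto
  qed
  ultimately have joint_has_sum: "((\<lambda>(t, y). pmf ?Y y * xlog (pmf (cond_law J y) t))
      has_sum measure_pmf.expectation J ?log) (UNIV \<times> UNIV)"
    by (subst (asm) has_sum_swap) simp
  show row_integrable: "integrable (measure_pmf ?Y) (\<lambda>y. xlog (pmf (cond_law J y) t))" for t
    unfolding integrable_measure_pmf_iff_summable_on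
    using summable_on_SigmaD1[OF has_sum_imp_summable[OF joint_has_sum], of t] by simp
  have "measure_pmf.expectation J ?log = mut_info J - ent ?T"
    using parts_integrable by (simp add: mut_info_eq_expectation ent_map_eq_expectation)
  then show "((\<lambda>t. measure_pmf.expectation ?Y (\<lambda>y. xlog (pmf (cond_law J y) t)))
      has_sum (mut_info J - ent ?T)) UNIV"
    using has_sum_SigmaD[OF joint_has_sum, of "\<lambda>t. measure_pmf.expectation ?Y (\<lambda>y. xlog (pmf (cond_law J y) t))"]
      has_sum_expectation_pmf[OF row_integrable] by simp
qed

lemma expectation_xlog_cond_law_le_level_integral:
  fixes J :: "('y \<times> 's \<times> 't) pmf"
  defines "YT \<equiv> map_pmf (apsnd snd) J"
  assumes finite_S: "finite (set_pmf S)" and finite_ent_T: "finite_ent (map_pmf snd YT)"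
    and indep: "map_pmf (apsnd fst) J = pair_pmf (map_pmf fst J) S"
  shows "measure_pmf.expectation (map_pmf fst YT) (\<lambda>y. xlog (pmf (cond_law YT y) t))
    \<le> level_integral xlog S (\<lambda>s. pmf (map_pmf snd J) (s, t) / pmf S s)"
proof -
  let ?Y = "map_pmf fst J"
  have fst_YT: "map_pmf fst YT = ?Y"
    by (simp add: YT_def map_pmf_comp)
  have prior: "map_pmf fst (cond_law J y) = S" if "y \<in> set_pmf ?Y" for y
    using that by (simp add: cond_law_pair_pmf indep flip: cond_law_map)
  have posterior: "cond_law YT y = map_pmf snd (cond_law J y)" if "y \<in> set_pmf ?Y" for y
    using that by (simp add: YT_def cond_law_map)
  have "integrable (measure_pmf ?Y) (\<lambda>y. xlog (pmf (map_pmf snd (cond_law J y)) t))"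
    using integrable_xlog_cond_law[OF finite_ent_T, of t] unfolding fst_YT
    by (subst integrable_cong_AE) (auto intro!: AE_pmfI simp: posterior)
  note level = expectation_posterior_le_level_integral[OF finite_S convex_on_xlog xlog_0 prior this]
  have "measure_pmf.expectation ?Y (\<lambda>y. xlog (pmf (cond_law YT y) t))
      = measure_pmf.expectation ?Y (\<lambda>y. xlog (pmf (map_pmf snd (cond_law J y)) t))"
    by (intro integral_cong_AE AE_pmfI) (simp_all add: posterior)
  also have "\<dots> \<le> level_integral xlog S (\<lambda>s. pmf (map_pmf snd J) (s, t) / pmf S s)"
    using level by (simp only: bind_cond_law)
  finally show ?thesis
    by (simp only: fst_YT)
qed

lemma mut_info_le_level_integral:
  fixes J :: "('y \<times> 's \<times> 't) pmf"
  defines "S \<equiv> map_pmf (\<lambda>(y, s, t). s) J" and "T \<equiv> map_pmf (\<lambda>(y, s, t). t) J"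
  assumes finite_S: "finite (set_pmf S)" and finite_ent_T: "finite_ent T"
    and indep: "mut_info (map_pmf (apsnd fst) J) = 0"
  shows "mut_info (map_pmf (apsnd snd) J)
    \<le> ent T + (\<Sum>\<^sub>\<infinity>t. level_integral xlog S (\<lambda>s. pmf (map_pmf snd J) (s, t) / pmf S s))"
proof -
  define YT where "YT = map_pmf (apsnd snd) J"
  define gain where "gain t = measure_pmf.expectation (map_pmf fst YT) (\<lambda>y. xlog (pmf (cond_law YT y) t))" for t
  define bound where "bound t = level_integral xlog S (\<lambda>s. pmf (map_pmf snd J) (s, t) / pmf S s)" for t
  have marginals: "map_pmf snd YT = T" "map_pmf fst (map_pmf (apsnd fst) J) = map_pmf fst J"
    "map_pmf snd (map_pmf (apsnd fst) J) = S"
    by (simp_all add: S_def T_def YT_def map_pmf_comp case_prod_unfold)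
  have "map_pmf (apsnd fst) J = pair_pmf (map_pmf fst J) S"
    using mut_info_eq_0_iff[of "map_pmf (apsnd fst) J"] indep finite_ent_if_finite_support[OF finite_S]
    by (simp add: marginals marginal_product_def)
  then have gain_le: "gain t \<le> bound t" for t
    unfolding gain_def bound_def YT_def using finite_S finite_ent_T
    by (intro expectation_xlog_cond_law_le_level_integral) (simp_all add: marginals flip: YT_def)
  have gain: "(gain has_sum (mut_info YT - ent T)) UNIV"
    using has_sum_expectation_xlog_cond_law[of YT] finite_ent_T by (simp add: gain_def[abs_def] marginals)
  have bound_nonpos: "bound t \<le> 0" for t
    unfolding bound_def by (intro level_integral_nonpos xlog_nonpos)
  have "(\<lambda>t. - gain t) summable_on UNIV"
    using has_sum_imp_summable[OF gain] summable_on_uminus[of gain UNIV] by simp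
  then have "(\<lambda>t. - bound t) summable_on UNIV"
    by (rule summable_on_comparison_test) (use gain_le bound_nonpos in auto)
  then have "bound summable_on UNIV"
    using summable_on_uminus[of bound UNIV] by simp
  then have "mut_info YT - ent T \<le> (\<Sum>\<^sub>\<infinity>t. bound t)"
    by (intro has_sum_mono[OF gain has_sum_infsum] gain_le)
  then show ?thesis
    by (simp add: YT_def bound_def)
qed

section \<open>Representations\<close>

text \<open>For the trade-off, \<open>\<omega> = (S, X, T)\<close> and \<open>f\<close> selects \<open>S\<close>, \<open>X\<close>, \<open>T\<close> or \<open>(X, S)\<close>.\<close>

definition repr_law :: "'o pmf \<Rightarrow> ('o \<Rightarrow> 'y pmf) \<Rightarrow> ('o \<Rightarrow> 'c) \<Rightarrow> ('y \<times> 'c) pmf" where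
  "repr_law P K f = bind_pmf P (\<lambda>\<omega>. map_pmf (\<lambda>y. (y, f \<omega>)) (K \<omega>))"

definition repr_info :: "'o pmf \<Rightarrow> ('o \<Rightarrow> 'y pmf) \<Rightarrow> ('o \<Rightarrow> 'c) \<Rightarrow> real" where
  "repr_info P K f = mut_info (repr_law P K f)"

lemma map_fst_repr_law [simp]: "map_pmf fst (repr_law P K f) = bind_pmf P K"
  by (simp add: repr_law_def map_bind_pmf map_pmf_comp)

lemma map_snd_repr_law [simp]: "map_pmf snd (repr_law P K f) = map_pmf f P"
  by (simp add: repr_law_def map_bind_pmf map_pmf_comp) (simp add: map_pmf_def)

lemma repr_law_comp: "repr_law P K (\<lambda>\<omega>. h (f \<omega>)) = map_pmf (apsnd h) (repr_law P K f)"
  by (simp add: repr_law_def map_bind_pmf map_pmf_comp)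

lemma repr_info_comp_le:
  assumes "finite_ent (map_pmf f P)"
  shows "repr_info P K (\<lambda>\<omega>. h (f \<omega>)) \<le> repr_info P K f"
  unfolding repr_info_def repr_law_comp by (rule mut_info_map_snd_le) (simp add: assms)

lemma repr_info_comp_eq_0:
  assumes finite_ent_f: "finite_ent (map_pmf f P)" and "repr_info P K f = 0"
  shows "repr_info P K (\<lambda>\<omega>. h (f \<omega>)) = 0"
proof -
  have "0 \<le> repr_info P K (\<lambda>\<omega>. h (f \<omega>))"
    using finite_ent_map[OF finite_ent_f, of h] by (simp add: repr_info_def mut_info_nonneg map_pmf_comp)
  with assms repr_info_comp_le[OF finite_ent_f, of K h] show ?thesis by simp
qed

lemma repr_info_le_add_cond_ent:
  assumes finite_ent_A: "finite_ent (map_pmf A P)" and finite_ent_B: "finite_ent (map_pmf B P)"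
  shows "repr_info P K B \<le> repr_info P K A + cond_ent (map_pmf (\<lambda>\<omega>. (B \<omega>, A \<omega>)) P)"
proof -
  let ?BA = "\<lambda>\<omega>. (B \<omega>, A \<omega>)"
  have finite_ent_BA: "finite_ent (map_pmf ?BA P)"
    by (rule finite_ent_joint) (use finite_ent_A finite_ent_B in \<open>simp_all add: map_pmf_comp\<close>)
  have "repr_info P K (\<lambda>\<omega>. fst (?BA \<omega>)) \<le> repr_info P K ?BA"
    by (rule repr_info_comp_le[OF finite_ent_BA])
  also have "\<dots> \<le> repr_info P K (\<lambda>\<omega>. snd (?BA \<omega>)) + cond_ent (map_pmf ?BA P)"
    using mut_info_le_add_ent_diff[of "repr_law P K ?BA" snd] finite_ent_BA
    by (simp add: repr_info_def cond_ent_def flip: repr_law_comp)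
  finally show ?thesis by simp
qed

lemma repr_info_le_level_integral:
  fixes S :: "'o \<Rightarrow> 's" and T :: "'o \<Rightarrow> 't"
  assumes "finite (S ` set_pmf P)" "finite_ent (map_pmf T P)" "repr_info P K S = 0"
  shows "repr_info P K T \<le> ent (map_pmf T P) + (\<Sum>\<^sub>\<infinity>t. level_integral xlog (map_pmf S P)
    (\<lambda>s. pmf (map_pmf (\<lambda>\<omega>. (S \<omega>, T \<omega>)) P) (s, t) / pmf (map_pmf S P) s))"
proof -
  let ?J = "repr_law P K (\<lambda>\<omega>. (S \<omega>, T \<omega>))"
  have "map_pmf (\<lambda>(y, s, t). s) ?J = map_pmf fst (map_pmf snd ?J)"
    "map_pmf (\<lambda>(y, s, t). t) ?J = map_pmf snd (map_pmf snd ?J)"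
    by (simp_all only: map_pmf_comp case_prod_unfold)
  then have marginals: "map_pmf (\<lambda>(y, s, t). s) ?J = map_pmf S P" "map_pmf (\<lambda>(y, s, t). t) ?J = map_pmf T P"
    by (simp_all only: map_snd_repr_law map_pmf_comp fst_conv snd_conv)
  show ?thesis
    using mut_info_le_level_integral[of ?J] assms
    unfolding marginals map_snd_repr_law repr_info_def by (simp flip: repr_law_comp)
qed

lemma repr_info_map_kernel_inj:
  assumes "inj_on e (set_pmf (bind_pmf P K))"
  shows "repr_info P (\<lambda>\<omega>. map_pmf e (K \<omega>)) f = repr_info P K f"
proof -
  have "repr_law P (\<lambda>\<omega>. map_pmf e (K \<omega>)) f = map_pmf (apfst e) (repr_law P K f)"
    by (simp add: repr_law_def map_bind_pmf map_pmf_comp)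
  then show ?thesis
    using assms by (simp add: repr_info_def mut_info_map_fst_inj del: set_bind_pmf)
qed

lemma repr_law_eq_pair_pmf:
  fixes P :: "'o pmf" and W :: "'o \<Rightarrow> 'w" and T :: "'o \<Rightarrow> 't"
  defines "J \<equiv> map_pmf (\<lambda>\<omega>. (W \<omega>, T \<omega>)) P"
  assumes mixture: "\<And>w. w \<in> W ` set_pmf P \<Longrightarrow> bind_pmf (cond_law J w) (\<kappa> w) = \<nu>"
  shows "repr_law P (\<lambda>\<omega>. \<kappa> (W \<omega>) (T \<omega>)) W = pair_pmf \<nu> (map_pmf W P)"
proof -
  have fst_J: "map_pmf fst J = map_pmf W P"
    by (simp add: J_def map_pmf_comp)
  have "repr_law P (\<lambda>\<omega>. \<kappa> (W \<omega>) (T \<omega>)) W = bind_pmf J (\<lambda>(w, t). map_pmf (\<lambda>y. (y, w)) (\<kappa> w t))"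
    by (simp add: repr_law_def J_def bind_map_pmf)
  also have "\<dots> = bind_pmf (map_pmf W P) (\<lambda>w. bind_pmf (cond_law J w) (\<lambda>t. map_pmf (\<lambda>y. (y, w)) (\<kappa> w t)))"
    by (subst bind_Pair_cond_law[symmetric]) (simp add: bind_assoc_pmf bind_map_pmf fst_J)
  also have "\<dots> = bind_pmf (map_pmf W P) (\<lambda>w. map_pmf (\<lambda>y. (y, w)) \<nu>)"
    by (intro bind_pmf_cong refl) (simp add: mixture[symmetric] map_bind_pmf)
  also have "\<dots> = pair_pmf \<nu> (map_pmf W P)"
    by (simp add: pair_pmf_def map_pmf_def) (rule bind_commute_pmf)
  finally show ?thesis .
qed

subsection \<open>Time sharing\<close>

lemma has_sum_sum:
  fixes f :: "'i \<Rightarrow> 'a \<Rightarrow> real"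
  assumes "finite I" "\<And>i. i \<in> I \<Longrightarrow> (f i has_sum c i) A"
  shows "((\<lambda>x. \<Sum>i\<in>I. f i x) has_sum (\<Sum>i\<in>I. c i)) A"
  using assms by (induction I rule: finite_induct) (auto intro: has_sum_add)

lemma expectation_bind_pmf_finite:
  fixes g :: "'b \<Rightarrow> real"
  assumes finite_support: "finite (set_pmf p)"
    and g_integrable: "\<And>x. x \<in> set_pmf p \<Longrightarrow> integrable (measure_pmf (f x)) g"
  shows "measure_pmf.expectation (bind_pmf p f) g
    = measure_pmf.expectation p (\<lambda>x. measure_pmf.expectation (f x) g)"
proof -
  have expand: "measure_pmf.expectation p h = (\<Sum>x\<in>set_pmf p. pmf p x * h x)" for h :: "'a \<Rightarrow> real"
    using finite_support by (subst integral_measure_pmf_real[of "set_pmf p"]) (auto simp: mult.commute)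
  have "((\<lambda>y. \<Sum>x\<in>set_pmf p. pmf p x * (pmf (f x) y * g y)) has_sum
      (\<Sum>x\<in>set_pmf p. pmf p x * measure_pmf.expectation (f x) g)) UNIV"
    by (intro has_sum_sum finite_support has_sum_cmult_right has_sum_expectation_pmf g_integrable)
  also have "(\<lambda>y. \<Sum>x\<in>set_pmf p. pmf p x * (pmf (f x) y * g y)) = (\<lambda>y. pmf (bind_pmf p f) y * g y)"
    by (simp add: fun_eq_iff pmf_bind expand sum_distrib_right mult.assoc)
  finally show ?thesis
    unfolding expand expectation_pmf_eq_infsum[of "bind_pmf p f"] by (rule infsumI)
qed

lemma pmf_bind_Pair:
  "pmf (bind_pmf p (\<lambda>x. map_pmf (Pair x) (f x))) (x, y) = pmf p x * pmf (f x) y"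
proof -
  have "pmf (map_pmf (Pair x') (f x')) (x, y) = indicator {x} x' * pmf (f x) y" for x'
    using pmf_map_inj'[of "Pair x" "f x" y]
    by (cases "x = x'") (auto simp: inj_on_def pmf_eq_0_set_pmf)
  then show ?thesis
    by (simp add: pmf_bind measure_pmf_single)
qed

lemma mut_info_mixture:
  fixes J :: "'b \<Rightarrow> ('y \<times> 'c) pmf"
  assumes finite_B: "finite (set_pmf B)" and marginal: "\<And>b. b \<in> set_pmf B \<Longrightarrow> map_pmf snd (J b) = R"
    and finite_ent_R: "finite_ent R"
  shows "mut_info (bind_pmf B (\<lambda>b. map_pmf (apfst (Pair b)) (J b)))
    = measure_pmf.expectation B (\<lambda>b. mut_info (J b))"
proof -
  define N where "N = bind_pmf B (\<lambda>b. map_pmf (Pair b) (J b))"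
  define M where "M = bind_pmf B (\<lambda>b. map_pmf (apfst (Pair b)) (J b))"
  have M_eq: "M = map_pmf (\<lambda>(b, y, c). ((b, y), c)) N"
    by (simp add: M_def N_def map_bind_pmf map_pmf_comp case_prod_unfold apfst_def map_prod_def)
  have pmf_M: "pmf M ((b, y), c) = pmf B b * pmf (J b) (y, c)" for b y c
    using pmf_map_inj'[of "\<lambda>(b, y, c). ((b, y), c)" N "(b, y, c)"]
    by (simp add: M_eq N_def pmf_bind_Pair inj_on_def)
  have "map_pmf fst M = bind_pmf B (\<lambda>b. map_pmf (Pair b) (map_pmf fst (J b)))"
    by (simp add: M_def map_bind_pmf map_pmf_comp)
  moreover have "map_pmf snd M = R"
    by (simp add: M_def map_bind_pmf map_pmf_comp marginal cong: bind_pmf_cong)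
  ultimately have density: "info_density M (apfst (Pair b) z) = info_density (J b) z" if "b \<in> set_pmf B" for b z
    using that
    by (cases z) (simp add: info_density_def pmf_marginal_product pmf_M pmf_bind_Pair marginal set_pmf_iff)
  have "mut_info M = measure_pmf.expectation B
        (\<lambda>b. measure_pmf.expectation (map_pmf (apfst (Pair b)) (J b)) (info_density M))"
    unfolding mut_info_eq_expectation
    by (subst (1) M_def, rule expectation_bind_pmf_finite[OF finite_B])
      (simp add: density integrable_info_density marginal finite_ent_R)
  also have "\<dots> = measure_pmf.expectation B (\<lambda>b. mut_info (J b))"
    by (intro integral_cong_AE AE_pmfI) (simp_all add: density mut_info_eq_expectation)
  finally show ?thesis
    by (simp add: M_def)
qed

lemma repr_info_mixture:
  assumes "finite (set_pmf B)" "finite_ent (map_pmf f P)"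
  shows "repr_info P (\<lambda>\<omega>. bind_pmf B (\<lambda>b. map_pmf (Pair b) (K b \<omega>))) f
    = measure_pmf.expectation B (\<lambda>b. repr_info P (K b) f)"
proof -
  have "repr_law P (\<lambda>\<omega>. bind_pmf B (\<lambda>b. map_pmf (Pair b) (K b \<omega>))) f
      = bind_pmf B (\<lambda>b. map_pmf (apfst (Pair b)) (repr_law P (K b) f))"
    unfolding repr_law_def map_bind_pmf
    by (subst bind_commute_pmf) (simp add: map_bind_pmf map_pmf_comp)
  then show ?thesis
    using mut_info_mixture[of B "\<lambda>b. repr_law P (K b) f"] assms by (simp add: repr_info_def)
qed

section \<open>Functional representations\<close>

lemma Pi_pmf_resample:
  assumes "finite F" "w \<in> F"
  shows "bind_pmf (p w) (\<lambda>t. map_pmf (\<lambda>g. g(w := t)) (Pi_pmf F d p)) = Pi_pmf F d p"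
proof -
  let ?rest = "Pi_pmf (F - {w}) d p"
  have split_component: "Pi_pmf F d p = bind_pmf (p w) (\<lambda>t. map_pmf (\<lambda>g. g(w := t)) ?rest)"
    using assms Pi_pmf_insert'[of "F - {w}" w d p] by (simp add: insert_absorb map_pmf_def)
  show ?thesis
    by (subst (1) split_component) (simp add: split_component map_bind_pmf map_pmf_comp)
qed

text \<open>The representation is an independent family of copies of \<open>T\<close> given \<open>W = w\<close>, for \<open>w \<in> F\<close>,
  whose component at the actual value of \<open>W\<close> is replaced by \<open>T\<close>.\<close>

definition functional_kernel :: "'w set \<Rightarrow> ('w \<times> 't) pmf \<Rightarrow> 'w \<Rightarrow> 't \<Rightarrow> ('w \<Rightarrow> 't) pmf" where
  "functional_kernel F J w t =
    (let copies = Pi_pmf F undefined (cond_law J)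
     in if w \<in> F then map_pmf (\<lambda>g. g(w := t)) copies else copies)"

lemma bind_functional_kernel:
  assumes "finite F"
  shows "bind_pmf (cond_law J w) (functional_kernel F J w) = Pi_pmf F undefined (cond_law J)"
  using Pi_pmf_resample[OF assms, of w "cond_law J"]
  by (cases "w \<in> F") (simp_all add: functional_kernel_def[abs_def] Let_def)

lemma functional_kernel_apply:
  "g \<in> set_pmf (functional_kernel F J w t) \<Longrightarrow> w \<in> F \<Longrightarrow> g w = t"
  by (auto simp: functional_kernel_def Let_def)

lemma nn_integral_pair_pmf_kernel_ratio_le:
  "(\<integral>\<^sup>+z. ennreal (pmf (D (fst z)) (snd z) / pmf q (snd z)) \<partial>measure_pmf (pair_pmf p q)) \<le> 1"
proof -
  have "(\<integral>\<^sup>+t. ennreal (pmf (D y) t / pmf q t) \<partial>measure_pmf q) \<le> 1" for y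
    using nn_integral_pmf_ratio_le[of q "\<lambda>_. 1" "D y"] by simp
  then have "(\<integral>\<^sup>+y. \<integral>\<^sup>+t. ennreal (pmf (D y) t / pmf q t) \<partial>measure_pmf q \<partial>measure_pmf p)
      \<le> (\<integral>\<^sup>+y. 1 \<partial>measure_pmf p)"
    by (intro nn_integral_mono)
  then show ?thesis
    by (simp add: nn_integral_pair_pmf')
qed

lemma repr_info_ge_decoder:
  fixes D :: "'y \<Rightarrow> 't pmf"
  assumes finite_ent_T: "finite_ent (map_pmf T P)" and f_integrable: "integrable (measure_pmf P) f"
    and f_le_log: "\<And>\<omega> y. \<omega> \<in> set_pmf P \<Longrightarrow> y \<in> set_pmf (K \<omega>) \<Longrightarrow>
      0 < pmf (D y) (T \<omega>) \<and> f \<omega> \<le> log 2 (pmf (D y) (T \<omega>))"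
  shows "ent (map_pmf T P) + measure_pmf.expectation P f \<le> repr_info P K T"
proof -
  define N where "N = repr_law P K (\<lambda>\<omega>. \<omega>)"
  define PT where "PT = map_pmf T P"
  have snd_N: "map_pmf snd N = P"
    by (simp add: N_def)
  have integrable_snd: "integrable (measure_pmf N) (\<lambda>n. h (snd n)) \<longleftrightarrow> integrable (measure_pmf P) h"
    and expectation_snd: "measure_pmf.expectation N (\<lambda>n. h (snd n)) = measure_pmf.expectation P h"
    for h :: "'a \<Rightarrow> real"
    using integrable_map_pmf_eq[of snd N h] integral_map_pmf[of snd N h] unfolding snd_N by simp_all
  have log_T: "integrable (measure_pmf P) (\<lambda>\<omega>. log 2 (pmf PT (T \<omega>)))"
    using finite_ent_T by (simp add: finite_ent_map_iff PT_def)
  have map_N: "map_pmf (apsnd T) N = repr_law P K T"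
    using repr_law_comp[of P K T "\<lambda>\<omega>. \<omega>"] by (simp add: N_def)
  have "measure_pmf.expectation N (\<lambda>n. f (snd n) - log 2 (pmf PT (T (snd n)))) \<le> mut_info (map_pmf (apsnd T) N)"
  proof (rule expectation_le_mut_info)
    show "finite_ent (map_pmf snd (map_pmf (apsnd T) N))"
      using finite_ent_T by (simp add: map_N)
    show "(\<integral>\<^sup>+z. ennreal (pmf (D (fst z)) (snd z) / pmf PT (snd z))
        \<partial>measure_pmf (marginal_product (map_pmf (apsnd T) N))) \<le> 1"
      unfolding map_N marginal_product_def map_snd_repr_law PT_def
      by (rule nn_integral_pair_pmf_kernel_ratio_le)
    show "integrable (measure_pmf N) (\<lambda>n. f (snd n) - log 2 (pmf PT (T (snd n))))"
      using f_integrable log_T integrable_snd[of "\<lambda>\<omega>. f \<omega> - log 2 (pmf PT (T \<omega>))"] by simp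
    fix n assume "n \<in> set_pmf N"
    then obtain y \<omega> where split_n: "n = (y, \<omega>)" "\<omega> \<in> set_pmf P" "y \<in> set_pmf (K \<omega>)"
      by (auto simp: N_def repr_law_def)
    then have "0 < pmf PT (T \<omega>)"
      by (auto simp: PT_def intro!: pmf_positive)
    with f_le_log[OF split_n(2,3)] show "0 < pmf (D (fst (apsnd T n))) (snd (apsnd T n)) / pmf PT (snd (apsnd T n))
        \<and> f (snd n) - log 2 (pmf PT (T (snd n)))
          \<le> log 2 (pmf (D (fst (apsnd T n))) (snd (apsnd T n)) / pmf PT (snd (apsnd T n)))"
      by (simp add: split_n log_divide)
  qed
  then show ?thesis
    using f_integrable log_T expectation_snd[of "\<lambda>\<omega>. f \<omega> - log 2 (pmf PT (T \<omega>))"]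
    by (simp add: map_N repr_info_def ent_map_eq_expectation[of T P, folded PT_def] flip: PT_def)
qed

text \<open>A decoder who knows the family guesses \<open>W\<close> according to its law and reads off the component;
  the guess of \<open>T\<close> is right with probability at least \<open>P(W)\<close> on \<open>W \<in> F\<close>.\<close>

definition functional_decoder :: "'w set \<Rightarrow> ('w \<times> 't) pmf \<Rightarrow> ('w \<Rightarrow> 't) \<Rightarrow> 't pmf" where
  "functional_decoder F J y = map_pmf (\<lambda>(w, t). if w \<in> F then y w else t) J"

definition log_tail :: "'w set \<Rightarrow> ('w \<times> 't) pmf \<Rightarrow> 'w \<times> 't \<Rightarrow> real" where
  "log_tail F J z = (if fst z \<in> F then 0 else \<bar>log 2 (pmf J z)\<bar>)"

lemma integrable_log_tail:
  assumes "finite_ent J"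
  shows "integrable (measure_pmf J) (log_tail F J)"
proof (rule Bochner_Integration.integrable_bound)
  show "integrable (measure_pmf J) (\<lambda>z. log 2 (pmf J z))"
    using assms by (simp add: finite_ent_iff_integrable)
qed (auto simp: log_tail_def)

lemma log_pmf_functional_decoder_ge:
  assumes support: "(w, t) \<in> set_pmf J" and family: "y \<in> set_pmf (functional_kernel F J w t)"
  shows "0 < pmf (functional_decoder F J y) t
    \<and> log 2 (pmf (map_pmf fst J) w) - log_tail F J (w, t) \<le> log 2 (pmf (functional_decoder F J y) t)"
proof -
  let ?D = "functional_decoder F J y"
  have pos: "0 < pmf (map_pmf fst J) w" "0 < pmf J (w, t)"
    using support by (force simp: pmf_positive_iff)+
  show ?thesis
  proof (cases "w \<in> F")
    case True
    then have "y w = t"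
      using family by (rule functional_kernel_apply[rotated])
    then have "pmf (map_pmf fst J) w \<le> pmf ?D t"
      unfolding functional_decoder_def pmf_map using True by (intro measure_pmf.finite_measure_mono) auto
    then show ?thesis
      using pos True by (simp add: log_tail_def)
  next
    case False
    then have "pmf J (w, t) \<le> pmf ?D t"
      using pmf_le_pmf_map[of J "(w, t)" "\<lambda>(w, t). if w \<in> F then y w else t"]
      by (simp add: functional_decoder_def)
    then have "0 < pmf ?D t" "log 2 (pmf J (w, t)) \<le> log 2 (pmf ?D t)"
      using pos by simp_all
    then show ?thesis
      using False log_pmf_nonpos[of "map_pmf fst J" w] by (auto simp: log_tail_def)
  qed
qed

lemma repr_info_functional_kernel_ge:
  fixes P :: "'o pmf" and W :: "'o \<Rightarrow> 'w" and T :: "'o \<Rightarrow> 't"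
  defines "J \<equiv> map_pmf (\<lambda>\<omega>. (W \<omega>, T \<omega>)) P"
  assumes finite_ent_W: "finite_ent (map_pmf W P)" and finite_ent_T: "finite_ent (map_pmf T P)"
  shows "ent (map_pmf T P) - ent (map_pmf W P) - measure_pmf.expectation J (log_tail F J)
    \<le> repr_info P (\<lambda>\<omega>. functional_kernel F J (W \<omega>) (T \<omega>)) T"
proof -
  define gain where "gain \<omega> = log 2 (pmf (map_pmf W P) (W \<omega>)) - log_tail F J (W \<omega>, T \<omega>)" for \<omega>
  have marginals: "map_pmf fst J = map_pmf W P" "map_pmf snd J = map_pmf T P"
    by (simp_all add: J_def map_pmf_comp)
  have "integrable (measure_pmf J) (log_tail F J)"
    by (intro integrable_log_tail finite_ent_joint) (simp_all add: marginals finite_ent_W finite_ent_T)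
  then have tail_integrable: "integrable (measure_pmf P) (\<lambda>\<omega>. log_tail F J (W \<omega>, T \<omega>))"
    by (subst (asm) J_def) simp
  have log_W_integrable: "integrable (measure_pmf P) (\<lambda>\<omega>. log 2 (pmf (map_pmf W P) (W \<omega>)))"
    using finite_ent_W by (simp add: finite_ent_map_iff)
  have "ent (map_pmf T P) + measure_pmf.expectation P gain
      \<le> repr_info P (\<lambda>\<omega>. functional_kernel F J (W \<omega>) (T \<omega>)) T"
  proof (rule repr_info_ge_decoder[OF finite_ent_T, where D = "functional_decoder F J"])
    show "integrable (measure_pmf P) gain"
      unfolding gain_def using log_W_integrable tail_integrable by simp
    fix \<omega> y assume "\<omega> \<in> set_pmf P" "y \<in> set_pmf (functional_kernel F J (W \<omega>) (T \<omega>))"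
    then show "0 < pmf (functional_decoder F J y) (T \<omega>) \<and> gain \<omega> \<le> log 2 (pmf (functional_decoder F J y) (T \<omega>))"
      unfolding gain_def marginals(1)[symmetric]
      by (intro log_pmf_functional_decoder_ge) (simp_all add: J_def)
  qed
  moreover have "measure_pmf.expectation J (log_tail F J)
      = measure_pmf.expectation P (\<lambda>\<omega>. log_tail F J (W \<omega>, T \<omega>))"
    by (subst J_def) simp
  then have "measure_pmf.expectation P gain = - ent (map_pmf W P) - measure_pmf.expectation J (log_tail F J)"
    unfolding gain_def using log_W_integrable tail_integrable by (simp add: ent_map_eq_expectation)
  ultimately show ?thesis by simp
qed

lemma functional_representation:
  fixes P :: "'o pmf" and W :: "'o \<Rightarrow> 'w" and T :: "'o \<Rightarrow> 't"
  assumes finite_ent_W: "finite_ent (map_pmf W P)" and finite_ent_T: "finite_ent (map_pmf T P)" and "0 < e"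
  obtains K :: "'o \<Rightarrow> ('w \<Rightarrow> 't) pmf" where
    "repr_info P K W = 0" "ent (map_pmf T P) - ent (map_pmf W P) - e \<le> repr_info P K T"
proof -
  define J where "J = map_pmf (\<lambda>\<omega>. (W \<omega>, T \<omega>)) P"
  have finite_ent_J: "finite_ent J"
    by (rule finite_ent_joint) (use finite_ent_W finite_ent_T in \<open>simp_all add: J_def map_pmf_comp\<close>)
  then have log_J_integrable: "integrable (measure_pmf J) (\<lambda>z. log 2 (pmf J z))"
    by (simp add: finite_ent_iff_integrable)
  then obtain G where "finite G"
    and tail_G: "measure_pmf.expectation J (\<lambda>z. if z \<in> G then 0 else \<bar>log 2 (pmf J z)\<bar>) \<le> e"
    using \<open>0 < e\<close> by (rule expectation_pmf_tail_le)
  define F where "F = fst ` G"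
  have "measure_pmf.expectation J (log_tail F J)
      \<le> measure_pmf.expectation J (\<lambda>z. if z \<in> G then 0 else \<bar>log 2 (pmf J z)\<bar>)"
    by (intro integral_mono_AE integrable_log_tail finite_ent_J
        Bochner_Integration.integrable_bound[OF log_J_integrable])
      (auto simp: F_def log_tail_def)
  with tail_G have "measure_pmf.expectation J (log_tail F J) \<le> e"
    by simp
  then have "ent (map_pmf T P) - ent (map_pmf W P) - e
      \<le> repr_info P (\<lambda>\<omega>. functional_kernel F J (W \<omega>) (T \<omega>)) T"
    using repr_info_functional_kernel_ge[OF finite_ent_W finite_ent_T, of F, folded J_def] by simp
  moreover have "finite F"
    using \<open>finite G\<close> by (simp add: F_def)
  then have "repr_info P (\<lambda>\<omega>. functional_kernel F J (W \<omega>) (T \<omega>)) W = 0"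
    by (simp add: repr_info_def repr_law_eq_pair_pmf[where \<nu> = "Pi_pmf F undefined (cond_law J)"]
        bind_functional_kernel flip: J_def)
  ultimately show ?thesis
    using that by blast
qed

section \<open>The exponential race\<close>

definition distr_pmf :: "'a measure \<Rightarrow> ('a \<Rightarrow> 'b) \<Rightarrow> 'b pmf" where
  "distr_pmf M f = Abs_pmf (distr M (count_space UNIV) f)"

lemma measure_pmf_distr_pmf:
  assumes "prob_space M" and measurable_f: "f \<in> measurable M (count_space UNIV)"
    and countable_range: "countable (f ` space M)"
  shows "measure_pmf (distr_pmf M f) = distr M (count_space UNIV) f"
  unfolding distr_pmf_def
proof (rule Abs_pmf_inverse, intro CollectI conjI)
  interpret M: prob_space M by fact
  show prob_space_distr: "prob_space (distr M (count_space UNIV) f)"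
    by (rule M.prob_space_distr[OF measurable_f])
  interpret D: prob_space "distr M (count_space UNIV) f" by fact
  have "AE x in distr M (count_space UNIV) f. x \<in> f ` space M"
    using measurable_f by (subst AE_distr_iff) auto
  with countable_range show "AE x in distr M (count_space UNIV) f. measure (distr M (count_space UNIV) f) {x} \<noteq> 0"
    by (subst D.AE_support_countable) auto
qed simp

lemma measurable_count_space_countable_range:
  assumes "countable (f ` space M)" "\<And>y. f -` {y} \<inter> space M \<in> sets M"
  shows "f \<in> measurable M (count_space UNIV)"
proof -
  have "f \<in> measurable M (count_space (f ` space M))"
    using assms by (subst measurable_count_space_eq_countable) auto
  then show ?thesis
    by (rule measurable_compose) simp
qed

abbreviation exp1 :: "real measure" where
  "exp1 \<equiv> density lborel (exponential_density 1)"

lemma prob_space_exp1: "prob_space exp1"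
  by (rule prob_space_exponential_density) simp

lemma AE_exp1_nonneg: "AE x in exp1. 0 \<le> x"
  by (auto simp: AE_density exponential_density_def)

lemma nn_integral_exp1:
  assumes [measurable]: "f \<in> borel_measurable borel"
  shows "(\<integral>\<^sup>+x. f x \<partial>exp1) = (\<integral>\<^sup>+x. f x * ennreal (exp (- x)) * indicator {0..} x \<partial>lborel)"
  by (subst nn_integral_density)
    (auto intro!: nn_integral_cong simp: exponential_density_def mult.commute split: split_indicator)

lemma emeasure_exp1_greaterThan:
  assumes "0 \<le> a"
  shows "emeasure exp1 {a<..} = ennreal (exp (- a))"
proof -
  interpret prob_space exp1 by (rule prob_space_exp1)
  have "distributed exp1 lborel (\<lambda>x. x) (exponential_density 1)"
    by (auto simp: distributed_def distr_id2)
  from exponential_distributedD_gt[OF this assms]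
  show ?thesis
    by (simp add: emeasure_eq_measure greaterThan_def)
qed

lemma nn_integral_power_exp_decay:
  fixes l :: real
  assumes "0 < l"
  shows "(\<integral>\<^sup>+x. ennreal (x ^ i * exp (- x * l)) * indicator {0..} x \<partial>lborel) = ennreal (fact i / l ^ (i + 1))"
proof -
  have "(\<integral>\<^sup>+x. ennreal (x ^ i * exp (- x * l)) * indicator {0..} x \<partial>lborel)
      = (\<integral>\<^sup>+x. ennreal (1 / l) * ennreal (exponential_density l x * x ^ i) \<partial>lborel)"
    using assms by (intro nn_integral_cong)
      (auto simp: exponential_density_def ennreal_mult'[symmetric] mult_ac split: split_indicator)
  also have "\<dots> = ennreal (1 / l) * ennreal (fact i / l ^ i)"
    using nn_integral_erlang_ith_moment[OF assms(1), of 0 i] by (subst nn_integral_cmult) simp_all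
  finally show ?thesis
    using assms by (simp add: ennreal_mult'[symmetric])
qed

lemma nn_integral_shifted_powr:
  fixes b p \<epsilon> :: real
  assumes b_pos: "0 < b" and p_pos: "0 < p" and eps_pos: "0 < \<epsilon>"
  shows "(\<integral>\<^sup>+x. ennreal ((x / p + b) powr (- \<epsilon> - 1)) * indicator {0..} x \<partial>lborel)
    = ennreal (p * b powr (- \<epsilon>) / \<epsilon>)"
proof -
  let ?F = "\<lambda>x. - (p / \<epsilon>) * (x / p + b) powr (- \<epsilon>)"
  have shifted_pos: "0 < x / p + b" if "0 \<le> x" for x
    using that b_pos p_pos by (simp add: add_nonneg_pos)
  have "(\<integral>\<^sup>+x. ennreal ((x / p + b) powr (- \<epsilon> - 1)) * indicator {0..} x \<partial>lborel) = ennreal (0 - ?F 0)"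
  proof (rule nn_integral_FTC_atLeast)
    show "DERIV ?F x :> (x / p + b) powr (- \<epsilon> - 1)" if "0 \<le> x" for x
      using shifted_pos[OF that] p_pos eps_pos
      by (auto intro!: derivative_eq_intros simp: field_simps)
    show "(?F \<longlongrightarrow> 0) at_top"
      using p_pos eps_pos by real_asymp
  qed auto
  then show ?thesis by simp
qed

definition round_up :: "nat \<Rightarrow> real \<Rightarrow> real" where
  "round_up n x = real (nat \<lceil>real n * x\<rceil>) / real n"

lemma round_up_ge: "0 < n \<Longrightarrow> max 0 x \<le> round_up n x"
  using of_nat_ceiling[of "real n * x"] by (simp add: round_up_def field_simps)

lemma round_up_le:
  assumes "0 < n"
  shows "round_up n x \<le> max 0 x + 1 / real n"
proof -
  have "real (nat \<lceil>real n * x\<rceil>) \<le> max 0 (real n * x) + 1"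
    by linarith
  also have "max 0 (real n * x) = real n * max 0 x"
    by (simp add: max_mult_distrib_left)
  finally show ?thesis
    using assms by (simp add: round_up_def field_simps)
qed

lemma borel_measurable_round_up [measurable]: "round_up n \<in> borel_measurable borel"
  unfolding round_up_def[abs_def] by measurable

lemma countable_range_round_up: "countable (range (round_up n))"
  by (rule countable_subset[of _ "range (\<lambda>k. real k / real n)"]) (auto simp: round_up_def)

locale exp_race =
  fixes I :: "'u set" and n :: nat
  assumes finite_I: "finite I" and n_pos: "0 < n"
begin

definition clocks :: "('u \<Rightarrow> real) measure" where
  "clocks = PiM I (\<lambda>_. exp1)"

text \<open>The event that \<open>t\<close> has the smallest clock after all clocks have been divided by the weights \<open>q\<close>.\<close>

definition wins :: "'u pmf \<Rightarrow> 'u \<Rightarrow> ('u \<Rightarrow> real) set" where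
  "wins q t = {e \<in> space clocks. \<forall>t'\<in>I - {t}. e t * pmf q t' < e t' * pmf q t}"

text \<open>Rounding makes the law of the clocks discrete.\<close>

definition rounded :: "('u \<Rightarrow> real) \<Rightarrow> 'u \<Rightarrow> real" where
  "rounded e t = (if t \<in> I then round_up n (e t) else 0)"

definition race_law :: "('u \<Rightarrow> real) pmf" where
  "race_law = distr_pmf clocks rounded"

definition race_kernel :: "'u pmf \<Rightarrow> 'u \<Rightarrow> ('u \<Rightarrow> real) pmf" where
  "race_kernel q t = distr_pmf (uniform_measure clocks (wins q t)) rounded"

sublocale Clocks: product_prob_space "\<lambda>_. exp1" I
  by (simp add: product_prob_space_def product_sigma_finite_def product_prob_space_axioms_def
      prob_space_exp1 prob_space_imp_sigma_finite)

lemma prob_space_clocks: "prob_space clocks"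
  unfolding clocks_def by (intro prob_space_PiM prob_space_exp1)

lemma sets_clocks [measurable_cong]: "sets clocks = sets (PiM I (\<lambda>_. borel))"
  unfolding clocks_def by (intro sets_PiM_cong) auto

lemma space_clocks: "space clocks = Pi\<^sub>E I (\<lambda>_. UNIV)"
  by (simp add: clocks_def space_PiM)

lemma measurable_clock: "t \<in> I \<Longrightarrow> (\<lambda>e. e t) \<in> borel_measurable clocks"
  unfolding measurable_cong_sets[OF sets_clocks refl] by (rule measurable_component_singleton)

lemma distr_clock:
  assumes "t \<in> I"
  shows "distr clocks exp1 (\<lambda>e. e t) = exp1"
  unfolding clocks_def by (rule Clocks.PiM_component[OF assms])

lemma sets_wins:
  assumes "t \<in> I"
  shows "wins q t \<in> sets clocks"
  unfolding wins_def
proof (rule sets.sets_Collect_finite_All)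
  fix t' assume "t' \<in> I - {t}"
  then have [measurable]: "(\<lambda>e. e t) \<in> borel_measurable clocks" "(\<lambda>e. e t') \<in> borel_measurable clocks"
    using assms by (auto intro: measurable_clock)
  show "{e \<in> space clocks. e t * pmf q t' < e t' * pmf q t} \<in> sets clocks" by measurable
qed (use finite_I in simp)

lemma disjoint_wins:
  assumes "t \<in> I" "t' \<in> I" "t \<noteq> t'"
  shows "wins q t \<inter> wins q t' = {}"
proof (rule ccontr)
  assume "wins q t \<inter> wins q t' \<noteq> {}"
  then obtain e where "e \<in> wins q t" "e \<in> wins q t'" by auto
  then have "e t * pmf q t' < e t' * pmf q t" "e t' * pmf q t < e t * pmf q t'"
    using assms by (auto simp: wins_def)
  then show False by simp
qed

lemma sum_indicator_wins_le:
  assumes "A \<subseteq> I"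
  shows "(\<Sum>t\<in>A. indicator (wins q t) e :: ennreal) \<le> 1"
proof (cases "\<exists>t\<in>A. e \<in> wins q t")
  case True
  then obtain t where winner: "t \<in> A" "e \<in> wins q t" by auto
  then have "indicator (wins q t') e = (if t' = t then 1 else 0 :: ennreal)" if "t' \<in> A" for t'
    using disjoint_wins[of t t' q] that assms by (auto simp: indicator_def)
  then show ?thesis
    using winner finite_subset[OF assms finite_I] by simp
qed simp

text \<open>If \<open>t\<close> wins with clock \<open>x\<close>, the other clocks exceed \<open>x q(t') / q(t)\<close>,
  and these thresholds add up to \<open>x (1 - q(t)) / q(t)\<close>.\<close>

lemma fun_upd_in_wins_iff:
  assumes t_in_I: "t \<in> I" and q_pos: "0 < pmf q t" and e_space: "e \<in> space (PiM (I - {t}) (\<lambda>_. exp1))"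
  shows "e(t := x) \<in> wins q t \<longleftrightarrow> e \<in> Pi\<^sub>E (I - {t}) (\<lambda>t'. {x * pmf q t' / pmf q t <..})"
proof -
  have "e(t := x) \<in> space clocks"
    using e_space t_in_I by (auto simp: space_clocks space_PiM PiE_def extensional_def)
  then show ?thesis
    using e_space q_pos by (auto simp: wins_def space_PiM PiE_iff pos_divide_less_eq)
qed

lemma emeasure_losing_clocks:
  assumes q_support: "set_pmf q \<subseteq> I" and t_support: "t \<in> set_pmf q" and x_nonneg: "0 \<le> x"
  shows "emeasure (PiM (I - {t}) (\<lambda>_. exp1)) (Pi\<^sub>E (I - {t}) (\<lambda>t'. {x * pmf q t' / pmf q t <..}))
    = ennreal (exp (- x * ((1 - pmf q t) / pmf q t)))"
proof -
  have "(\<Sum>t'\<in>I. pmf q t') = 1"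
    using finite_I q_support by (rule sum_pmf_eq_1)
  then have "(\<Sum>t'\<in>I - {t}. pmf q t') = 1 - pmf q t"
    using q_support t_support finite_I by (subst sum_diff1) auto
  then have thresholds: "(\<Sum>t'\<in>I - {t}. - (x * pmf q t' / pmf q t)) = - x * ((1 - pmf q t) / pmf q t)"
    by (metis (no_types) mult_minus_left sum_distrib_left sum_divide_distrib sum_negf times_divide_eq_right)
  have "emeasure (PiM (I - {t}) (\<lambda>_. exp1)) (Pi\<^sub>E (I - {t}) (\<lambda>t'. {x * pmf q t' / pmf q t <..}))
      = (\<Prod>t'\<in>I - {t}. emeasure exp1 {x * pmf q t' / pmf q t <..})"
    by (rule Clocks.emeasure_PiM) (use finite_I in auto)
  also have "\<dots> = (\<Prod>t'\<in>I - {t}. ennreal (exp (- (x * pmf q t' / pmf q t))))"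
    using x_nonneg by (intro prod.cong refl emeasure_exp1_greaterThan) simp
  also have "\<dots> = ennreal (exp (- x * ((1 - pmf q t) / pmf q t)))"
    using finite_I thresholds by (simp add: prod_ennreal flip: exp_sum)
  finally show ?thesis .
qed

lemma nn_integral_wins_slice:
  fixes h :: "real \<Rightarrow> ennreal"
  assumes q_support: "set_pmf q \<subseteq> I" and t_support: "t \<in> set_pmf q" and x_nonneg: "0 \<le> x"
  shows "(\<integral>\<^sup>+e. h ((e(t := x)) t) * indicator (wins q t) (e(t := x)) \<partial>PiM (I - {t}) (\<lambda>_. exp1))
    = h x * ennreal (exp (- x * ((1 - pmf q t) / pmf q t)))"
proof -
  define losing where "losing = Pi\<^sub>E (I - {t}) (\<lambda>t'. {x * pmf q t' / pmf q t <..})"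
  have "t \<in> I" "0 < pmf q t"
    using q_support t_support by (auto intro: pmf_positive)
  then have "(\<integral>\<^sup>+e. h ((e(t := x)) t) * indicator (wins q t) (e(t := x)) \<partial>PiM (I - {t}) (\<lambda>_. exp1))
      = (\<integral>\<^sup>+e. h x * indicator losing e \<partial>PiM (I - {t}) (\<lambda>_. exp1))"
    by (intro nn_integral_cong) (simp add: indicator_def fun_upd_in_wins_iff losing_def)
  also have "\<dots> = h x * emeasure (PiM (I - {t}) (\<lambda>_. exp1)) losing"
    unfolding losing_def using finite_I by (intro nn_integral_cmult_indicator sets_PiM_I_finite) auto
  finally show ?thesis
    unfolding losing_def emeasure_losing_clocks[OF q_support t_support x_nonneg] .
qed

lemma nn_integral_wins:
  assumes q_support: "set_pmf q \<subseteq> I" and t_support: "t \<in> set_pmf q"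
    and h_measurable [measurable]: "h \<in> borel_measurable borel"
  shows "(\<integral>\<^sup>+e. h (e t) * indicator (wins q t) e \<partial>clocks)
    = (\<integral>\<^sup>+x. h x * ennreal (exp (- x * (1 / pmf q t))) * indicator {0..} x \<partial>lborel)"
proof -
  let ?rate = "(1 - pmf q t) / pmf q t"
  have I_split: "insert t (I - {t}) = I" "finite (I - {t})" "t \<notin> I - {t}" "t \<in> I"
    using q_support t_support finite_I by auto
  have "(\<lambda>e. h (e t) * indicator (wins q t) e) \<in> borel_measurable clocks"
    using measurable_clock[OF I_split(4)] sets_wins[OF I_split(4)] by measurable
  then have "(\<integral>\<^sup>+e. h (e t) * indicator (wins q t) e \<partial>clocks)
      = (\<integral>\<^sup>+x. (\<integral>\<^sup>+e. h ((e(t := x)) t) * indicator (wins q t) (e(t := x)) \<partial>PiM (I - {t}) (\<lambda>_. exp1)) \<partial>exp1)"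
    using Clocks.product_nn_integral_insert_rev[OF I_split(2,3), of "\<lambda>e. h (e t) * indicator (wins q t) e"]
    by (simp only: I_split(1) clocks_def)
  also have "\<dots> = (\<integral>\<^sup>+x. h x * ennreal (exp (- x * ?rate)) \<partial>exp1)"
    using AE_exp1_nonneg
    by (intro nn_integral_cong_AE)
      (auto elim!: eventually_mono simp only: nn_integral_wins_slice[OF q_support t_support])
  also have "\<dots> = (\<integral>\<^sup>+x. h x * ennreal (exp (- x * ?rate)) * ennreal (exp (- x)) * indicator {0..} x \<partial>lborel)"
    by (rule nn_integral_exp1) measurable
  also have "\<dots> = (\<integral>\<^sup>+x. h x * ennreal (exp (- x * (1 / pmf q t))) * indicator {0..} x \<partial>lborel)"
  proof -
    have "ennreal (exp (- x * ?rate)) * ennreal (exp (- x)) = ennreal (exp (- x * (1 / pmf q t)))" for x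
      by (subst ennreal_mult'[symmetric])
        (use pmf_positive[OF t_support] in \<open>simp_all add: field_simps flip: exp_add\<close>)
    then have "h x * ennreal (exp (- x * ?rate)) * ennreal (exp (- x))
        = h x * ennreal (exp (- x * (1 / pmf q t)))" for x
      by (simp only: mult.assoc)
    then show ?thesis
      by (simp only:)
  qed
  finally show ?thesis .
qed

lemma emeasure_wins:
  assumes "set_pmf q \<subseteq> I" "t \<in> set_pmf q"
  shows "emeasure clocks (wins q t) = ennreal (pmf q t)"
proof -
  have "emeasure clocks (wins q t) = (\<integral>\<^sup>+e. 1 * indicator (wins q t) e \<partial>clocks)"
    using sets_wins[of t q] assms by auto
  also have "\<dots> = ennreal (pmf q t)"
    using nn_integral_wins[OF assms, of "\<lambda>_. 1"] nn_integral_power_exp_decay[of "1 / pmf q t" 0]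
      pmf_positive[OF assms(2)]
    by simp
  finally show ?thesis .
qed

lemma countable_range_rounded: "countable (rounded ` A)"
proof (rule countable_subset)
  show "rounded ` A \<subseteq> (\<lambda>f t. if t \<in> I then f t else 0) ` Pi\<^sub>E I (\<lambda>_. range (round_up n))"
  proof
    fix y assume "y \<in> rounded ` A"
    then obtain e where y_eq: "y = rounded e" by auto
    show "y \<in> (\<lambda>f t. if t \<in> I then f t else 0) ` Pi\<^sub>E I (\<lambda>_. range (round_up n))"
      by (rule image_eqI[of _ _ "\<lambda>t\<in>I. round_up n (e t)"]) (auto simp: y_eq rounded_def fun_eq_iff)
  qed
  show "countable ((\<lambda>f t. if t \<in> I then f t else 0) ` Pi\<^sub>E I (\<lambda>_. range (round_up n)))"
    by (rule countable_image, rule countable_PiE[OF finite_I], rule countable_range_round_up)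
qed

lemma measurable_rounded: "rounded \<in> measurable clocks (count_space UNIV)"
proof (rule measurable_count_space_countable_range[OF countable_range_rounded])
  fix y
  have "rounded -` {y} \<inter> space clocks
      = (if \<forall>t. t \<notin> I \<longrightarrow> y t = 0 then {e \<in> space clocks. \<forall>t\<in>I. round_up n (e t) = y t} else {})"
    by (auto simp: rounded_def fun_eq_iff)
  moreover have "{e \<in> space clocks. \<forall>t\<in>I. round_up n (e t) = y t} \<in> sets clocks"
  proof (rule sets.sets_Collect_finite_All[OF _ finite_I])
    fix t assume "t \<in> I"
    then have [measurable]: "(\<lambda>e. e t) \<in> borel_measurable clocks"
      by (rule measurable_clock)
    show "{e \<in> space clocks. round_up n (e t) = y t} \<in> sets clocks" by measurable
  qed
  ultimately show "rounded -` {y} \<inter> space clocks \<in> sets clocks" by simp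
qed

lemma nn_integral_race_law: "(\<integral>\<^sup>+y. f y \<partial>measure_pmf race_law) = (\<integral>\<^sup>+e. f (rounded e) \<partial>clocks)"
  unfolding race_law_def
    measure_pmf_distr_pmf[OF prob_space_clocks measurable_rounded countable_range_rounded]
  by (rule nn_integral_distr[OF measurable_rounded]) simp

lemma nn_integral_race_kernel:
  assumes q_support: "set_pmf q \<subseteq> I" and t_support: "t \<in> set_pmf q"
  shows "(\<integral>\<^sup>+y. f y \<partial>measure_pmf (race_kernel q t))
    = (\<integral>\<^sup>+e. f (rounded e) * indicator (wins q t) e \<partial>clocks) / ennreal (pmf q t)"
proof -
  let ?U = "uniform_measure clocks (wins q t)"
  have t_in_I: "t \<in> I"
    using q_support t_support by auto
  have "prob_space ?U"
    by (rule prob_space_uniform_measure)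
      (use emeasure_wins[OF q_support t_support] pmf_positive[OF t_support] in auto)
  moreover have measurable_rounded_U: "rounded \<in> measurable ?U (count_space UNIV)"
    using measurable_rounded by (subst measurable_cong_sets[OF sets_uniform_measure refl])
  ultimately have "(\<integral>\<^sup>+y. f y \<partial>measure_pmf (race_kernel q t)) = (\<integral>\<^sup>+e. f (rounded e) \<partial>?U)"
    unfolding race_kernel_def
    by (subst measure_pmf_distr_pmf[OF _ _ countable_range_rounded]) (simp_all add: nn_integral_distr)
  also have "\<dots> = (\<integral>\<^sup>+e. f (rounded e) * indicator (wins q t) e \<partial>clocks) / emeasure clocks (wins q t)"
    using sets_wins[OF t_in_I]
    by (intro nn_integral_uniform_measure measurable_compose[OF measurable_rounded]) simp_all
  finally show ?thesis
    by (simp add: emeasure_wins[OF q_support t_support])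
qed

lemma bind_race_kernel:
  assumes q_support: "set_pmf q \<subseteq> I"
  shows "bind_pmf q (race_kernel q) = race_law"
proof (rule ccontr)
  assume "bind_pmf q (race_kernel q) \<noteq> race_law"
  then obtain y where less: "pmf race_law y < pmf (bind_pmf q (race_kernel q)) y"
    using pmf_neq_exists_less by metis
  let ?hit = "\<lambda>e. indicator {y} (rounded e) :: ennreal"
  have hit_measurable [measurable]: "?hit \<in> borel_measurable clocks"
    by (rule measurable_compose[OF measurable_rounded]) simp
  have finite_support: "finite (set_pmf q)"
    using q_support finite_I by (rule finite_subset)
  have "ennreal (pmf (bind_pmf q (race_kernel q)) y)
      = (\<integral>\<^sup>+t. \<integral>\<^sup>+y'. indicator {y} y' \<partial>measure_pmf (race_kernel q t) \<partial>measure_pmf q)"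
    by (simp add: ennreal_pmf_bind emeasure_pmf_single)
  also have "\<dots> = (\<Sum>t\<in>set_pmf q. (\<integral>\<^sup>+y'. indicator {y} y' \<partial>measure_pmf (race_kernel q t)) * ennreal (pmf q t))"
    by (rule nn_integral_measure_pmf_finite[OF finite_support]) simp
  also have "\<dots> = (\<Sum>t\<in>set_pmf q. \<integral>\<^sup>+e. ?hit e * indicator (wins q t) e \<partial>clocks)"
  proof (rule sum.cong[OF refl])
    fix t assume t_support: "t \<in> set_pmf q"
    show "(\<integral>\<^sup>+y'. indicator {y} y' \<partial>measure_pmf (race_kernel q t)) * ennreal (pmf q t)
        = (\<integral>\<^sup>+e. ?hit e * indicator (wins q t) e \<partial>clocks)"
      unfolding nn_integral_race_kernel[OF q_support t_support] ennreal_divide_times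
      using pmf_positive[OF t_support]
      by simp
  qed
  also have "\<dots> = (\<integral>\<^sup>+e. (\<Sum>t\<in>set_pmf q. ?hit e * indicator (wins q t) e) \<partial>clocks)"
    using sets_wins q_support by (intro nn_integral_sum[symmetric]) auto
  also have "\<dots> \<le> (\<integral>\<^sup>+e. ?hit e \<partial>clocks)"
    using sum_indicator_wins_le[OF q_support, of q]
    by (intro nn_integral_mono) (simp add: mult_left_le flip: sum_distrib_left)
  also have "\<dots> = ennreal (pmf race_law y)"
    by (simp add: emeasure_pmf_single flip: nn_integral_race_law)
  finally show False
    using less by simp
qed

lemma race_law_nonneg: "y \<in> set_pmf race_law \<Longrightarrow> 0 \<le> y t"
proof -
  have "AE y in measure_pmf race_law. 0 \<le> y t"
    unfolding race_law_def
      measure_pmf_distr_pmf[OF prob_space_clocks measurable_rounded countable_range_rounded]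
    by (subst AE_distr_iff[OF measurable_rounded]) (auto simp: rounded_def round_up_def)
  then show "y \<in> set_pmf race_law \<Longrightarrow> 0 \<le> y t"
    by (simp add: AE_measure_pmf_iff)
qed

lemma nn_integral_race_law_powr_le:
  assumes t_in_I: "t \<in> I" and p_pos: "0 < p" and b_pos: "0 < b" and eps_pos: "0 < \<epsilon>"
  shows "(\<integral>\<^sup>+y. ennreal ((y t / p + b) powr (- \<epsilon> - 1)) \<partial>measure_pmf race_law) \<le> ennreal (p * b powr (- \<epsilon>) / \<epsilon>)"
proof -
  let ?f = "\<lambda>x. ennreal ((x / p + b) powr (- \<epsilon> - 1))"
  have "(\<integral>\<^sup>+y. ?f (y t) \<partial>measure_pmf race_law) \<le> (\<integral>\<^sup>+e. ?f (max 0 (e t)) \<partial>clocks)"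
    unfolding nn_integral_race_law
  proof (intro nn_integral_mono ennreal_leI powr_mono2')
    fix e
    show "0 < max 0 (e t) / p + b"
      using p_pos b_pos by (simp add: add_nonneg_pos)
    show "max 0 (e t) / p + b \<le> rounded e t / p + b"
      using round_up_ge[OF n_pos, of "e t"] p_pos t_in_I
      by (intro add_right_mono divide_right_mono) (auto simp: rounded_def)
  qed (use eps_pos in simp)
  also have "\<dots> = (\<integral>\<^sup>+x. ?f (max 0 x) \<partial>distr clocks exp1 (\<lambda>e. e t))"
    using measurable_clock[OF t_in_I] by (subst nn_integral_distr) simp_all
  also have "\<dots> = (\<integral>\<^sup>+x. ?f (max 0 x) * ennreal (exp (- x)) * indicator {0..} x \<partial>lborel)"
    unfolding distr_clock[OF t_in_I] by (rule nn_integral_exp1) measurable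
  also have "\<dots> \<le> (\<integral>\<^sup>+x. ?f x * indicator {0..} x \<partial>lborel)"
    by (intro nn_integral_mono)
      (auto simp: ennreal_mult'[symmetric] intro!: ennreal_leI mult_left_le split: split_indicator)
  also have "\<dots> = ennreal (p * b powr (- \<epsilon>) / \<epsilon>)"
    by (rule nn_integral_shifted_powr[OF b_pos p_pos eps_pos])
  finally show ?thesis .
qed

lemma nn_integral_winning_clock:
  assumes q_support: "set_pmf q \<subseteq> I" and t_support: "t \<in> set_pmf q"
  shows "(\<integral>\<^sup>+e. ennreal (e t) * indicator (wins q t) e \<partial>clocks) = ennreal (pmf q t * pmf q t)"
proof -
  have "(\<integral>\<^sup>+e. ennreal (e t) * indicator (wins q t) e \<partial>clocks)
      = (\<integral>\<^sup>+x. ennreal (x ^ 1 * exp (- x * (1 / pmf q t))) * indicator {0..} x \<partial>lborel)"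
    by (subst nn_integral_wins[OF q_support t_support])
      (auto intro!: nn_integral_cong simp: ennreal_mult' split: split_indicator)
  also have "\<dots> = ennreal (pmf q t * pmf q t)"
    using nn_integral_power_exp_decay[of "1 / pmf q t" 1] pmf_positive[OF t_support]
    by (simp add: power_divide power2_eq_square)
  finally show ?thesis .
qed

lemma nn_integral_race_kernel_le:
  assumes q_support: "set_pmf q \<subseteq> I" and t_support: "t \<in> set_pmf q"
  shows "(\<integral>\<^sup>+y. ennreal (y t) \<partial>measure_pmf (race_kernel q t)) \<le> ennreal (pmf q t + 1 / real n)"
proof -
  let ?win = "\<lambda>e. indicator (wins q t) e :: ennreal"
  have "t \<in> I"
    using q_support t_support by auto
  then have [measurable]: "(\<lambda>e. e t) \<in> borel_measurable clocks" "wins q t \<in> sets clocks"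
    by (rule measurable_clock, rule sets_wins)
  have rounded_le: "ennreal (rounded e t) \<le> ennreal (e t) + ennreal (1 / real n)" for e
  proof -
    have "ennreal (rounded e t) \<le> ennreal (max 0 (e t) + 1 / real n)"
      using round_up_le[OF n_pos, of "e t"] \<open>t \<in> I\<close> by (intro ennreal_leI) (simp add: rounded_def)
    also have "\<dots> = ennreal (e t) + ennreal (1 / real n)"
      by (subst ennreal_plus) simp_all
    finally show ?thesis .
  qed
  have "(\<integral>\<^sup>+e. ennreal (rounded e t) * ?win e \<partial>clocks)
      \<le> (\<integral>\<^sup>+e. ennreal (e t) * ?win e + ennreal (1 / real n) * ?win e \<partial>clocks)"
    unfolding distrib_right[symmetric] by (intro nn_integral_mono mult_right_mono rounded_le zero_le)
  also have "\<dots> = ennreal (pmf q t * pmf q t) + ennreal (1 / real n) * ennreal (pmf q t)"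
    by (simp add: nn_integral_add nn_integral_cmult nn_integral_winning_clock[OF q_support t_support]
        emeasure_wins[OF q_support t_support])
  also have "\<dots> = ennreal (pmf q t * (pmf q t + 1 / real n))"
    by (simp add: distrib_left mult.commute flip: ennreal_plus ennreal_mult')
  finally have "(\<integral>\<^sup>+y. ennreal (y t) \<partial>measure_pmf (race_kernel q t))
      \<le> ennreal (pmf q t * (pmf q t + 1 / real n)) / ennreal (pmf q t)"
    unfolding nn_integral_race_kernel[OF q_support t_support] by (rule divide_right_mono_ennreal)
  also have "\<dots> = ennreal (pmf q t + 1 / real n)"
    using pmf_positive[OF t_support] by (subst divide_ennreal) auto
  finally show ?thesis .
qed

end

section \<open>The strong functional representation\<close>

locale race_repr =
  fixes P :: "'o pmf" and W :: "'o \<Rightarrow> 'w" and T :: "'o \<Rightarrow> 't" and n :: nat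
  assumes finite_T: "finite (T ` set_pmf P)" and resolution_pos: "0 < n"
begin

sublocale exp_race "T ` set_pmf P" n
  using finite_T resolution_pos by unfold_locales

definition joint :: "('w \<times> 't) pmf" where
  "joint = map_pmf (\<lambda>\<omega>. (W \<omega>, T \<omega>)) P"

definition prior :: "'t \<Rightarrow> real" where
  "prior t = pmf (map_pmf T P) t"

definition kernel :: "'o \<Rightarrow> ('t \<Rightarrow> real) pmf" where
  "kernel \<omega> = race_kernel (cond_law joint (W \<omega>)) (T \<omega>)"

definition coupling :: "(('t \<Rightarrow> real) \<times> 'o) pmf" where
  "coupling = repr_law P kernel (\<lambda>\<omega>. \<omega>)"

definition clock :: "('t \<Rightarrow> real) \<times> 'o \<Rightarrow> real" where
  "clock z = fst z (T (snd z)) / prior (T (snd z))"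

definition ratio :: "'o \<Rightarrow> real" where
  "ratio \<omega> = product_ratio joint (W \<omega>, T \<omega>)"

lemma marginals: "map_pmf fst joint = map_pmf W P" "map_pmf snd joint = map_pmf T P"
  by (simp_all add: joint_def map_pmf_comp)

lemma
  fixes h :: "'w \<times> 't \<Rightarrow> real"
  shows integrable_joint: "integrable (measure_pmf joint) h \<longleftrightarrow> integrable (measure_pmf P) (\<lambda>\<omega>. h (W \<omega>, T \<omega>))"
    and expectation_joint: "measure_pmf.expectation joint h = measure_pmf.expectation P (\<lambda>\<omega>. h (W \<omega>, T \<omega>))"
  by (simp_all add: joint_def)

lemma finite_ent_T: "finite_ent (map_pmf T P)"
  by (rule finite_ent_if_finite_support) (simp add: finite_T)

lemma set_pmf_cond_law_source: "\<omega> \<in> set_pmf P \<Longrightarrow> set_pmf (cond_law joint (W \<omega>)) \<subseteq> T ` set_pmf P"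
  by (subst set_pmf_cond_law) (auto simp: joint_def image_image)

lemma repr_law_kernel: "repr_law P kernel W = pair_pmf race_law (map_pmf W P)"
  unfolding kernel_def
proof (rule repr_law_eq_pair_pmf, fold joint_def)
  fix w assume "w \<in> W ` set_pmf P"
  then show "bind_pmf (cond_law joint w) (race_kernel (cond_law joint w)) = race_law"
    using set_pmf_cond_law_source by (intro bind_race_kernel) auto
qed

lemma bind_kernel: "bind_pmf P kernel = race_law"
  using arg_cong[OF repr_law_kernel, of "map_pmf fst"] by (simp add: map_fst_pair_pmf)

lemma prior_pos: "\<omega> \<in> set_pmf P \<Longrightarrow> 0 < prior (T \<omega>)"
  by (simp add: prior_def pmf_positive)

lemma ratio_pos: "\<omega> \<in> set_pmf P \<Longrightarrow> 0 < ratio \<omega>"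
  unfolding ratio_def by (rule product_ratio_pos) (simp add: joint_def)

lemma clock_nonneg:
  assumes "z \<in> set_pmf coupling"
  shows "0 \<le> clock z"
proof -
  have "fst z \<in> set_pmf race_law"
    using assms unfolding bind_kernel[symmetric] by (auto simp: coupling_def repr_law_def)
  then show ?thesis
    by (simp add: clock_def prior_def race_law_nonneg)
qed

lemma set_pmf_coupling: "z \<in> set_pmf coupling \<Longrightarrow> snd z \<in> set_pmf P"
  by (auto simp: coupling_def repr_law_def)

lemma nn_integral_coupling:
  "(\<integral>\<^sup>+z. g z \<partial>measure_pmf coupling) = (\<integral>\<^sup>+\<omega>. \<integral>\<^sup>+y. g (y, \<omega>) \<partial>measure_pmf (kernel \<omega>) \<partial>measure_pmf P)"
  by (simp add: coupling_def repr_law_def)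

lemma
  fixes h :: "'o \<Rightarrow> real"
  shows integrable_coupling_snd:
      "integrable (measure_pmf coupling) (\<lambda>z. h (snd z)) \<longleftrightarrow> integrable (measure_pmf P) h"
    and expectation_coupling_snd:
      "measure_pmf.expectation coupling (\<lambda>z. h (snd z)) = measure_pmf.expectation P h"
  using integrable_map_pmf_eq[of snd coupling h] integral_map_pmf[of snd coupling h]
  by (simp_all add: coupling_def del: integrable_map_pmf_eq integral_map_pmf)

lemma nn_integral_kernel_clock_le:
  assumes support: "\<omega> \<in> set_pmf P" and "0 \<le> c"
  shows "(\<integral>\<^sup>+y. ennreal (c * clock (y, \<omega>)) \<partial>measure_pmf (kernel \<omega>))
    \<le> ennreal (c * (pmf (cond_law joint (W \<omega>)) (T \<omega>) + 1 / real n) / prior (T \<omega>))"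
proof -
  let ?scale = "c / prior (T \<omega>)"
  have T_support: "T \<omega> \<in> set_pmf (cond_law joint (W \<omega>))"
    using support by (subst set_pmf_cond_law) (auto simp: joint_def image_image)
  have scale_nonneg: "0 \<le> ?scale"
    using \<open>0 \<le> c\<close> by (simp add: prior_def)
  have "(\<integral>\<^sup>+y. ennreal (c * clock (y, \<omega>)) \<partial>measure_pmf (kernel \<omega>))
      = (\<integral>\<^sup>+y. ennreal ?scale * ennreal (y (T \<omega>)) \<partial>measure_pmf (kernel \<omega>))"
    using scale_nonneg by (simp add: clock_def flip: ennreal_mult')
  also have "\<dots> = ennreal ?scale * (\<integral>\<^sup>+y. ennreal (y (T \<omega>)) \<partial>measure_pmf (kernel \<omega>))"
    by (rule nn_integral_cmult) simp
  also have "\<dots> \<le> ennreal ?scale * ennreal (pmf (cond_law joint (W \<omega>)) (T \<omega>) + 1 / real n)"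
    unfolding kernel_def
    by (intro mult_left_mono nn_integral_race_kernel_le[OF set_pmf_cond_law_source[OF support] T_support]) simp
  also have "\<dots> = ennreal (c * (pmf (cond_law joint (W \<omega>)) (T \<omega>) + 1 / real n) / prior (T \<omega>))"
    using scale_nonneg by (simp del: ennreal_plus flip: ennreal_mult')
  finally show ?thesis .
qed

lemma integrable_clock: "integrable (measure_pmf coupling) clock"
proof (rule integrableI_nonneg)
  let ?bound = "\<lambda>t. (1 + 1 / real n) / prior t"
  have "(\<integral>\<^sup>+z. ennreal (clock z) \<partial>measure_pmf coupling) \<le> (\<integral>\<^sup>+\<omega>. ennreal (?bound (T \<omega>)) \<partial>measure_pmf P)"
    unfolding nn_integral_coupling
  proof (intro nn_integral_mono_AE AE_pmfI)
    fix \<omega> assume support: "\<omega> \<in> set_pmf P"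
    have "(\<integral>\<^sup>+y. ennreal (clock (y, \<omega>)) \<partial>measure_pmf (kernel \<omega>))
        \<le> ennreal ((pmf (cond_law joint (W \<omega>)) (T \<omega>) + 1 / real n) / prior (T \<omega>))"
      using nn_integral_kernel_clock_le[OF support, of 1] by simp
    also have "\<dots> \<le> ennreal (?bound (T \<omega>))"
      by (intro ennreal_leI divide_right_mono) (simp_all add: pmf_le_1 prior_def)
    finally show "(\<integral>\<^sup>+y. ennreal (clock (y, \<omega>)) \<partial>measure_pmf (kernel \<omega>)) \<le> ennreal (?bound (T \<omega>))" .
  qed
  also have "\<dots> = (\<integral>\<^sup>+t. ennreal (?bound t) \<partial>measure_pmf (map_pmf T P))"
    by simp
  also have "\<dots> = (\<Sum>t\<in>set_pmf (map_pmf T P). ennreal (?bound t) * ennreal (pmf (map_pmf T P) t))"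
    by (rule nn_integral_measure_pmf_finite) (simp_all add: finite_T)
  also have "\<dots> < \<infinity>"
    by (simp add: prior_def sum_ennreal flip: ennreal_mult')
  finally show "(\<integral>\<^sup>+z. ennreal (clock z) \<partial>measure_pmf coupling) < \<infinity>" .
qed (auto intro!: AE_pmfI simp: clock_nonneg)

lemma integrable_log_clock:
  assumes "0 < b"
  shows "integrable (measure_pmf coupling) (\<lambda>z. log 2 (clock z + b))"
proof (rule Bochner_Integration.integrable_bound)
  show "integrable (measure_pmf coupling) (\<lambda>z. \<bar>log 2 b\<bar> + clock z / b / ln 2)"
    using integrable_clock by simp
  show "AE z in measure_pmf coupling. norm (log 2 (clock z + b)) \<le> norm (\<bar>log 2 b\<bar> + clock z / b / ln 2)"
  proof (rule AE_pmfI)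
    fix z assume "z \<in> set_pmf coupling"
    then have clock_z_nonneg: "0 \<le> clock z"
      by (rule clock_nonneg)
    have "clock z + b = b * (1 + clock z / b)" "0 < 1 + clock z / b"
      using assms clock_z_nonneg by (simp_all add: field_simps add_pos_nonneg)
    then have "log 2 (clock z + b) = log 2 b + log 2 (1 + clock z / b)"
      using assms by (simp only: log_mult_pos)
    moreover have "0 \<le> log 2 (1 + clock z / b)" "log 2 (1 + clock z / b) \<le> clock z / b / ln 2"
      using clock_z_nonneg assms ln_add_one_self_le_self[of "clock z / b"]
      by (simp_all add: log_def divide_right_mono del: divide_divide_eq_left)
    ultimately show "norm (log 2 (clock z + b)) \<le> norm (\<bar>log 2 b\<bar> + clock z / b / ln 2)"
      unfolding real_norm_def by linarith
  qed
qed simp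

definition tilted_clock :: "real \<Rightarrow> ('t \<Rightarrow> real) \<times> 'o \<Rightarrow> real" where
  "tilted_clock b z = (clock z + b) * ratio (snd z)"

lemma tilted_clock_pos: "0 < b \<Longrightarrow> z \<in> set_pmf coupling \<Longrightarrow> 0 < tilted_clock b z"
  by (simp add: tilted_clock_def add_nonneg_pos clock_nonneg ratio_pos set_pmf_coupling)

lemma ratio_mult_cond_law:
  assumes "\<omega> \<in> set_pmf P"
  shows "ratio \<omega> * pmf (cond_law joint (W \<omega>)) (T \<omega>) = prior (T \<omega>)"
proof -
  have support: "W \<omega> \<in> fst ` set_pmf joint" "0 < pmf joint (W \<omega>, T \<omega>)" "0 < pmf (map_pmf W P) (W \<omega>)"
    using assms by (auto simp: joint_def image_image intro!: pmf_positive)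
  then show ?thesis
    using pmf_cond_law[OF support(1), of "T \<omega>"]
    by (simp add: ratio_def product_ratio_def pmf_marginal_product marginals prior_def)
qed

lemma nn_integral_kernel_tilted_clock_le:
  assumes support: "\<omega> \<in> set_pmf P" and b_pos: "0 < b" and fine: "1 / real n \<le> b * prior (T \<omega>)"
  shows "(\<integral>\<^sup>+y. ennreal (ratio \<omega> * clock (y, \<omega>)) + ennreal (b * ratio \<omega>) \<partial>measure_pmf (kernel \<omega>))
    \<le> ennreal (1 + 2 * b * ratio \<omega>)"
proof -
  have ratio_nonneg: "0 \<le> ratio \<omega>" "0 \<le> b * ratio \<omega>"
    using ratio_pos[OF support] b_pos by simp_all
  have "ratio \<omega> * (pmf (cond_law joint (W \<omega>)) (T \<omega>) + 1 / real n) / prior (T \<omega>)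
      = 1 + ratio \<omega> * (1 / real n / prior (T \<omega>))"
    using prior_pos[OF support] ratio_mult_cond_law[OF support] by (simp add: field_simps)
  also have "\<dots> \<le> 1 + b * ratio \<omega>"
  proof -
    have "1 / real n / prior (T \<omega>) \<le> b"
      using fine prior_pos[OF support] by (subst pos_divide_le_eq) simp_all
    with ratio_nonneg(1) show ?thesis
      by (subst mult.commute[of b]) (intro add_left_mono mult_left_mono)
  qed
  finally have "(\<integral>\<^sup>+y. ennreal (ratio \<omega> * clock (y, \<omega>)) \<partial>measure_pmf (kernel \<omega>)) \<le> ennreal (1 + b * ratio \<omega>)"
    using nn_integral_kernel_clock_le[OF support ratio_nonneg(1)] by (auto intro: order.trans ennreal_leI)
  then have "(\<integral>\<^sup>+y. ennreal (ratio \<omega> * clock (y, \<omega>)) + ennreal (b * ratio \<omega>) \<partial>measure_pmf (kernel \<omega>))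
      \<le> ennreal (1 + b * ratio \<omega>) + ennreal (b * ratio \<omega>)"
    by (simp add: nn_integral_add add_right_mono)
  also have "\<dots> = ennreal (1 + 2 * b * ratio \<omega>)"
    using ratio_nonneg by (simp flip: ennreal_plus)
  finally show ?thesis .
qed

lemma
  shows integrable_ratio: "integrable (measure_pmf P) ratio"
    and expectation_ratio_le: "measure_pmf.expectation P ratio \<le> 1"
  using integrable_product_ratio[of joint] expectation_product_ratio_le[of joint]
  unfolding ratio_def[abs_def] integrable_joint expectation_joint .

text \<open>By \<open>fine\<close>, rounding adds at most \<open>b\<close> to a clock divided by its prior.\<close>

lemma nn_integral_tilted_clock_le:
  assumes b_pos: "0 < b" and fine: "\<And>t. t \<in> T ` set_pmf P \<Longrightarrow> 1 / real n \<le> b * prior t"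
  shows "(\<integral>\<^sup>+z. ennreal (tilted_clock b z) \<partial>measure_pmf coupling) \<le> ennreal (1 + 2 * b)"
proof -
  have "ennreal (tilted_clock b z) = ennreal (ratio (snd z) * clock z) + ennreal (b * ratio (snd z))"
    if "z \<in> set_pmf coupling" for z
    using that b_pos
    by (simp add: tilted_clock_def clock_nonneg ratio_pos set_pmf_coupling less_imp_le
        algebra_simps flip: ennreal_plus)
  then have "(\<integral>\<^sup>+z. ennreal (tilted_clock b z) \<partial>measure_pmf coupling)
      = (\<integral>\<^sup>+z. ennreal (ratio (snd z) * clock z) + ennreal (b * ratio (snd z)) \<partial>measure_pmf coupling)"
    by (intro nn_integral_cong_AE AE_pmfI)
  also have "\<dots> \<le> (\<integral>\<^sup>+\<omega>. ennreal (1 + 2 * b * ratio \<omega>) \<partial>measure_pmf P)"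
    unfolding nn_integral_coupling snd_conv
    by (intro nn_integral_mono_AE AE_pmfI nn_integral_kernel_tilted_clock_le b_pos fine imageI)
  also have "\<dots> = ennreal (1 + 2 * b * measure_pmf.expectation P ratio)"
    using b_pos ratio_pos integrable_ratio
    by (subst nn_integral_eq_integral) (auto intro!: AE_pmfI simp: less_imp_le)
  also have "\<dots> \<le> ennreal (1 + 2 * b)"
    using b_pos expectation_ratio_le by (intro ennreal_leI) simp
  finally show ?thesis .
qed

definition density :: "'o \<Rightarrow> real" where
  "density \<omega> = info_density joint (W \<omega>, T \<omega>)"

lemma density_eq_minus_log_ratio: "density \<omega> = - log 2 (ratio \<omega>)"
  by (simp add: density_def ratio_def info_density_eq_minus_log)

lemma
  shows integrable_density: "integrable (measure_pmf P) density"
    and expectation_density: "measure_pmf.expectation P density = mut_info joint"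
  using integrable_info_density[of joint] finite_ent_T
  by (simp_all add: marginals integrable_joint mut_info_eq_expectation expectation_joint density_def[abs_def])

lemma expectation_log_clock_le:
  assumes b_pos: "0 < b" and fine: "\<And>t. t \<in> T ` set_pmf P \<Longrightarrow> 1 / real n \<le> b * prior t"
  shows "measure_pmf.expectation coupling (\<lambda>z. log 2 (clock z + b)) \<le> mut_info joint + log 2 (1 + 2 * b)"
proof -
  have tilted_nonneg: "AE z in measure_pmf coupling. 0 \<le> tilted_clock b z"
    using tilted_clock_pos[OF b_pos] by (intro AE_pmfI) (simp add: less_imp_le)
  have tilted_le: "(\<integral>\<^sup>+z. ennreal (tilted_clock b z) \<partial>measure_pmf coupling) \<le> ennreal (1 + 2 * b)"
    using assms by (rule nn_integral_tilted_clock_le)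
  have tilted_integrable: "integrable (measure_pmf coupling) (tilted_clock b)"
    by (rule integrableI_nonneg[OF _ tilted_nonneg]) (use tilted_le in \<open>auto intro: le_less_trans\<close>)
  have log_clock_integrable: "integrable (measure_pmf coupling) (\<lambda>z. log 2 (clock z + b))"
    by (rule integrable_log_clock[OF b_pos])
  have density_integrable: "integrable (measure_pmf coupling) (\<lambda>z. density (snd z))"
    using integrable_density by (simp add: integrable_coupling_snd)
  have "measure_pmf.expectation coupling (\<lambda>z. log 2 (clock z + b) - density (snd z)) \<le> log 2 (1 + 2 * b)"
  proof (rule measure_pmf.expectation_le_log[where x = "tilted_clock b"])
    show "measure_pmf.expectation coupling (tilted_clock b) \<le> 1 + 2 * b"
      using tilted_le b_pos unfolding nn_integral_eq_integral[OF tilted_integrable tilted_nonneg]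
      by (subst (asm) ennreal_le_iff) simp_all
    have "log 2 (clock z + b) - density (snd z) = log 2 (tilted_clock b z)" if "z \<in> set_pmf coupling" for z
      using that b_pos by (simp add: tilted_clock_def density_eq_minus_log_ratio log_mult_pos
          clock_nonneg add_nonneg_pos ratio_pos set_pmf_coupling)
    then show "AE z in measure_pmf coupling. 0 < tilted_clock b z
        \<and> log 2 (clock z + b) - density (snd z) \<le> log 2 (tilted_clock b z)"
      using tilted_clock_pos[OF b_pos] by (intro AE_pmfI) simp
  qed (use b_pos tilted_integrable log_clock_integrable density_integrable in auto)
  then show ?thesis
    using log_clock_integrable density_integrable by (simp add: expectation_coupling_snd expectation_density)
qed

text \<open>The likelihood ratio of a decoder who believes in \<open>t\<close> with weight proportional to \<open>(\<theta> + b) powr (- \<epsilon> - 1)\<close>,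
  where \<open>\<theta>\<close> is the clock of \<open>t\<close> divided by the prior probability of \<open>t\<close>.\<close>

definition belief :: "real \<Rightarrow> real \<Rightarrow> ('t \<Rightarrow> real) \<times> 't \<Rightarrow> real" where
  "belief b \<epsilon> z = (fst z (snd z) / prior (snd z) + b) powr (- \<epsilon> - 1) / (prior (snd z) * b powr (- \<epsilon>) / \<epsilon>)"

lemma nn_integral_belief_le:
  assumes b_pos: "0 < b" and eps_pos: "0 < \<epsilon>"
  shows "(\<integral>\<^sup>+z. ennreal (belief b \<epsilon> z) \<partial>measure_pmf (pair_pmf race_law (map_pmf T P))) \<le> 1"
proof -
  have "(\<integral>\<^sup>+y. ennreal (belief b \<epsilon> (y, t)) \<partial>measure_pmf race_law) \<le> 1" if t_support: "t \<in> T ` set_pmf P" for t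
  proof -
    let ?weight = "\<lambda>y. (y t / prior t + b) powr (- \<epsilon> - 1)"
    define c where "c = prior t * b powr (- \<epsilon>) / \<epsilon>"
    have prior_t_pos: "0 < prior t"
      using t_support by (auto simp: prior_pos)
    then have c_pos: "0 < c"
      using b_pos eps_pos by (simp add: c_def)
    have "(\<integral>\<^sup>+y. ennreal (belief b \<epsilon> (y, t)) \<partial>measure_pmf race_law)
        = (\<integral>\<^sup>+y. ennreal (1 / c) * ennreal (?weight y) \<partial>measure_pmf race_law)"
      using c_pos by (simp add: belief_def flip: ennreal_mult' c_def)
    also have "\<dots> = ennreal (1 / c) * (\<integral>\<^sup>+y. ennreal (?weight y) \<partial>measure_pmf race_law)"
      by (rule nn_integral_cmult) simp
    also have "\<dots> \<le> ennreal (1 / c) * ennreal c"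
      unfolding c_def using t_support prior_t_pos b_pos eps_pos
      by (intro mult_left_mono nn_integral_race_law_powr_le) simp_all
    also have "\<dots> = 1"
      using c_pos by (simp flip: ennreal_mult')
    finally show ?thesis .
  qed
  then have "(\<integral>\<^sup>+t. \<integral>\<^sup>+y. ennreal (belief b \<epsilon> (y, t)) \<partial>measure_pmf race_law \<partial>measure_pmf (map_pmf T P))
      \<le> (\<integral>\<^sup>+t. 1 \<partial>measure_pmf (map_pmf T P))"
    by (intro nn_integral_mono_AE AE_pmfI) simp
  then show ?thesis
    by (subst pair_commute_pmf) (simp add: nn_integral_pair_pmf' case_prod_unfold)
qed

lemma
  assumes b_pos: "0 < b" and eps_pos: "0 < \<epsilon>" and support: "z \<in> set_pmf coupling"
  shows belief_pos: "0 < belief b \<epsilon> (apsnd T z)"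
    and log_belief: "log 2 (belief b \<epsilon> (apsnd T z))
      = - (1 + \<epsilon>) * log 2 (clock z + b) + \<epsilon> * log 2 b + log 2 \<epsilon> - log 2 (prior (T (snd z)))"
proof -
  have pos: "0 < clock z + b" "0 < prior (T (snd z))"
    using b_pos support by (simp_all add: clock_nonneg add_nonneg_pos prior_pos set_pmf_coupling)
  have belief_eq: "belief b \<epsilon> (apsnd T z)
      = (clock z + b) powr (- \<epsilon> - 1) / (prior (T (snd z)) * b powr (- \<epsilon>) / \<epsilon>)"
    by (simp add: belief_def clock_def)
  show "0 < belief b \<epsilon> (apsnd T z)"
    unfolding belief_eq using pos b_pos eps_pos by simp
  show "log 2 (belief b \<epsilon> (apsnd T z))
      = - (1 + \<epsilon>) * log 2 (clock z + b) + \<epsilon> * log 2 b + log 2 \<epsilon> - log 2 (prior (T (snd z)))"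
    unfolding belief_eq using pos b_pos eps_pos by (simp add: log_divide log_mult log_powr algebra_simps)
qed

lemma repr_info_ge_expectation_log_clock:
  assumes b_pos: "0 < b" and eps_pos: "0 < \<epsilon>"
  shows "ent (map_pmf T P) - (1 + \<epsilon>) * measure_pmf.expectation coupling (\<lambda>z. log 2 (clock z + b))
      + \<epsilon> * log 2 b + log 2 \<epsilon> \<le> repr_info P kernel T"
proof -
  define log_prior where "log_prior \<omega> = log 2 (prior (T \<omega>))" for \<omega>
  define gain where "gain z = - (1 + \<epsilon>) * log 2 (clock z + b) + \<epsilon> * log 2 b + log 2 \<epsilon> - log_prior (snd z)" for z
  have "integrable (measure_pmf P) log_prior"
    unfolding log_prior_def prior_def using finite_ent_T by (simp add: finite_ent_map_iff)
  then have parts_integrable: "integrable (measure_pmf coupling) (\<lambda>z. log_prior (snd z))"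
    "integrable (measure_pmf coupling) (\<lambda>z. log 2 (clock z + b))"
    by (simp_all add: integrable_coupling_snd integrable_log_clock b_pos)
  have coupling_T: "map_pmf (apsnd T) coupling = repr_law P kernel T"
    using repr_law_comp[of P kernel T "\<lambda>\<omega>. \<omega>"] by (simp add: coupling_def)
  have "measure_pmf.expectation coupling gain \<le> mut_info (map_pmf (apsnd T) coupling)"
  proof (rule expectation_le_mut_info)
    show "finite_ent (map_pmf snd (map_pmf (apsnd T) coupling))"
      using finite_ent_T by (simp add: coupling_T)
    show "(\<integral>\<^sup>+z. ennreal (belief b \<epsilon> z) \<partial>measure_pmf (marginal_product (map_pmf (apsnd T) coupling))) \<le> 1"
      unfolding coupling_T marginal_product_def map_fst_repr_law map_snd_repr_law bind_kernel
      by (rule nn_integral_belief_le[OF b_pos eps_pos])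
    show "integrable (measure_pmf coupling) gain"
      unfolding gain_def using parts_integrable by simp
    show "0 < belief b \<epsilon> (apsnd T z) \<and> gain z \<le> log 2 (belief b \<epsilon> (apsnd T z))" if "z \<in> set_pmf coupling" for z
      using belief_pos[OF b_pos eps_pos that] log_belief[OF b_pos eps_pos that]
      by (simp add: gain_def log_prior_def)
  qed
  moreover have "measure_pmf.expectation coupling (\<lambda>z. log_prior (snd z)) = - ent (map_pmf T P)"
    unfolding expectation_coupling_snd by (simp add: ent_map_eq_expectation log_prior_def[abs_def] prior_def)
  ultimately show ?thesis
    using parts_integrable by (simp add: gain_def[abs_def] coupling_T repr_info_def algebra_simps)
qed

lemma repr_info_kernel_ge:
  assumes b_pos: "0 < b" and eps_pos: "0 < \<epsilon>" and fine: "\<And>t. t \<in> T ` set_pmf P \<Longrightarrow> 1 / real n \<le> b * prior t"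
  shows "ent (map_pmf T P) - (1 + \<epsilon>) * (mut_info joint + log 2 (1 + 2 * b)) + \<epsilon> * log 2 b + log 2 \<epsilon>
    \<le> repr_info P kernel T"
proof -
  have "(1 + \<epsilon>) * measure_pmf.expectation coupling (\<lambda>z. log 2 (clock z + b))
      \<le> (1 + \<epsilon>) * (mut_info joint + log 2 (1 + 2 * b))"
    using eps_pos by (intro mult_left_mono expectation_log_clock_le b_pos fine) simp_all
  then show ?thesis
    using repr_info_ge_expectation_log_clock[OF b_pos eps_pos] by linarith
qed

end

text \<open>The choice \<open>b = 1 / 32\<close>, \<open>\<epsilon> = 3 / (2 (I + log (17 / 16) + 5))\<close>
  yields the constants \<open>5.51\<close> and \<open>1.06\<close>.\<close>

lemma strong_functional_constants:
  fixes I :: real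
  assumes "0 \<le> I"
  obtains \<epsilon> where "0 < \<epsilon>"
    "- I - (log 2 (I + 5.51) + 1.06)
      \<le> - (1 + \<epsilon>) * (I + log 2 (1 + 2 * (1 / 32))) + \<epsilon> * log 2 (1 / 32) + log 2 \<epsilon>"
proof -
  define c where "c = log 2 (17 / 16 :: real)"
  define A where "A = I + c + 5"
  have "2 * c = log 2 ((17 / 16) ^ 2)"
    unfolding c_def by (subst log_nat_power) simp_all
  also have "\<dots> \<le> log 2 2"
    by (subst log_le_cancel_iff) (simp_all add: power2_eq_square)
  finally have c_bounds: "0 \<le> c" "c \<le> 1 / 2"
    by (simp_all add: c_def)
  have A_pos: "0 < A"
    using assms c_bounds by (simp add: A_def)
  have log_A: "log 2 A \<le> log 2 (I + 5.51)"
    using A_pos c_bounds assms by (subst log_le_cancel_iff) (simp_all add: A_def)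
  have "log 2 (17 / 16 / (3 / 2)) = c - log 2 (3 / 2)"
    unfolding c_def by (subst log_divide) simp_all
  then have "25 * (c - log 2 (3 / 2)) = log 2 ((17 / 24) ^ 25)"
    by (subst log_nat_power) simp_all
  also have "\<dots> \<le> log 2 (2 powr (- 11))"
    by (subst log_le_cancel_iff) (simp_all add: powr_minus powr_numeral power_divide divide_simps)
  finally have log_c: "c - log 2 (3 / 2) \<le> - 0.44"
    by simp
  define \<epsilon> where "\<epsilon> = 3 / 2 / A"
  have "0 < \<epsilon>" "\<epsilon> * A = 3 / 2"
    using A_pos by (simp_all add: \<epsilon>_def)
  moreover have "log 2 \<epsilon> = log 2 (3 / 2) - log 2 A"
    unfolding \<epsilon>_def using A_pos by (subst log_divide) simp
  moreover have "- (1 + \<epsilon>) * (I + log 2 (1 + 2 * (1 / 32))) + \<epsilon> * log 2 (1 / 32) + log 2 \<epsilon>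
      = - (I + c) - \<epsilon> * A + log 2 \<epsilon>"
  proof -
    have "log 2 (1 / 32 :: real) = - 5"
      using log_powr_cancel[of 2 "- 5"] by (simp add: powr_minus powr_numeral)
    then show ?thesis
      by (simp add: A_def c_def algebra_simps)
  qed
  ultimately show ?thesis
    using that[of \<epsilon>] log_A log_c by simp
qed

lemma strong_functional_representation_finite:
  fixes P :: "'o pmf" and W :: "'o \<Rightarrow> 'w" and T :: "'o \<Rightarrow> 't"
  defines "I \<equiv> mut_info (map_pmf (\<lambda>\<omega>. (W \<omega>, T \<omega>)) P)"
  assumes finite_T: "finite (T ` set_pmf P)"
  obtains K :: "'o \<Rightarrow> ('t \<Rightarrow> real) pmf" where
    "repr_info P K W = 0" "ent (map_pmf T P) - I - (log 2 (I + 5.51) + 1.06) \<le> repr_info P K T"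
proof -
  define m where "m = Min (pmf (map_pmf T P) ` T ` set_pmf P)"
  have m_min: "0 < m" "\<And>t. t \<in> T ` set_pmf P \<Longrightarrow> m \<le> pmf (map_pmf T P) t"
    unfolding m_def using finite_T set_pmf_not_empty[of P] by (auto simp: pmf_positive)
  obtain n where n_large: "0 < n" "1 / real n < 1 / 32 * m"
    using ex_inverse_of_nat_less[of "1 / 32 * m"] m_min(1) by (auto simp: inverse_eq_divide)
  interpret race_repr P W T n
    by unfold_locales (use finite_T n_large in auto)
  have I_eq: "I = mut_info joint"
    by (simp add: I_def joint_def)
  have "0 \<le> I"
    unfolding I_eq by (rule mut_info_nonneg) (simp add: marginals finite_ent_T)
  then obtain \<epsilon> where "0 < \<epsilon>" and constants: "- I - (log 2 (I + 5.51) + 1.06)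
      \<le> - (1 + \<epsilon>) * (I + log 2 (1 + 2 * (1 / 32))) + \<epsilon> * log 2 (1 / 32) + log 2 \<epsilon>"
    by (rule strong_functional_constants)
  have "1 / real n \<le> 1 / 32 * prior t" if "t \<in> T ` set_pmf P" for t
    using m_min(2)[OF that] n_large(2) by (simp add: prior_def)
  then have "ent (map_pmf T P) - (1 + \<epsilon>) * (I + log 2 (1 + 2 * (1 / 32))) + \<epsilon> * log 2 (1 / 32) + log 2 \<epsilon>
      \<le> repr_info P kernel T"
    unfolding I_eq using \<open>0 < \<epsilon>\<close> by (intro repr_info_kernel_ge) simp_all
  with constants have "ent (map_pmf T P) - I - (log 2 (I + 5.51) + 1.06) \<le> repr_info P kernel T"
    by linarith
  moreover have "repr_info P kernel W = 0"
    by (simp add: repr_info_def repr_law_kernel)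
  ultimately show ?thesis
    using that by blast
qed

definition truncate :: "'t set \<Rightarrow> 't \<Rightarrow> 't option" where
  "truncate G t = (if t \<in> G then Some t else None)"

lemma ent_truncate_ge:
  assumes finite_ent_p: "finite_ent p" and "0 < e"
  obtains G where "finite G" "ent p - e \<le> ent (map_pmf (truncate G) p)"
proof -
  have log_integrable: "integrable (measure_pmf p) (\<lambda>t. log 2 (pmf p t))"
    using finite_ent_p by (simp add: finite_ent_iff_integrable)
  then obtain G where finite_G: "finite G"
    and tail_le: "measure_pmf.expectation p (\<lambda>t. if t \<in> G then 0 else \<bar>log 2 (pmf p t)\<bar>) \<le> e"
    using \<open>0 < e\<close> by (rule expectation_pmf_tail_le)
  let ?q = "map_pmf (truncate G) p" and ?tail = "\<lambda>t. if t \<in> G then 0 else \<bar>log 2 (pmf p t)\<bar>"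
  have tail_integrable: "integrable (measure_pmf p) ?tail"
    by (rule Bochner_Integration.integrable_bound[OF log_integrable]) auto
  have "pmf ?q (Some t) = pmf p t" if "t \<in> G" for t
  proof -
    have "truncate G -` {Some t} = {t}"
      using that by (auto simp: truncate_def split: if_splits)
    then show ?thesis
      by (simp add: pmf_map measure_pmf_single)
  qed
  then have "- log 2 (pmf p t) - ?tail t \<le> - log 2 (pmf ?q (truncate G t))" for t
    using log_pmf_nonpos[of p t] log_pmf_nonpos[of ?q None] by (simp add: truncate_def)
  then have "measure_pmf.expectation p (\<lambda>t. - log 2 (pmf p t) - ?tail t)
      \<le> measure_pmf.expectation p (\<lambda>t. - log 2 (pmf ?q (truncate G t)))"
    using log_integrable tail_integrable finite_ent_map[OF finite_ent_p, of "truncate G"]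
    by (intro integral_mono_AE) (simp_all add: finite_ent_map_iff)
  also have "\<dots> = ent ?q"
    by (simp add: ent_map_eq_expectation)
  finally have "ent p - measure_pmf.expectation p ?tail \<le> ent ?q"
    using log_integrable tail_integrable by (simp add: ent_eq_expectation[of p])
  with tail_le that[OF finite_G] show ?thesis
    by simp
qed

lemma strong_functional_representation:
  fixes P :: "'o pmf" and W :: "'o \<Rightarrow> 'w" and T :: "'o \<Rightarrow> 't"
  defines "I \<equiv> mut_info (map_pmf (\<lambda>\<omega>. (W \<omega>, T \<omega>)) P)"
  assumes finite_ent_T: "finite_ent (map_pmf T P)" and "0 < e"
  obtains K :: "'o \<Rightarrow> ('t option \<Rightarrow> real) pmf" where
    "repr_info P K W = 0" "ent (map_pmf T P) - I - (log 2 (I + 5.51) + 1.06) - e \<le> repr_info P K T"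
proof -
  obtain G where "finite G"
    and ent_truncated: "ent (map_pmf T P) - e \<le> ent (map_pmf (truncate G) (map_pmf T P))"
    using ent_truncate_ge[OF finite_ent_T \<open>0 < e\<close>] .
  define T' where "T' \<omega> = truncate G (T \<omega>)" for \<omega>
  define I' where "I' = mut_info (map_pmf (\<lambda>\<omega>. (W \<omega>, T' \<omega>)) P)"
  have "T' ` set_pmf P \<subseteq> insert None (Some ` G)"
    by (auto simp: T'_def truncate_def)
  then have finite_T': "finite (T' ` set_pmf P)"
    using \<open>finite G\<close> by (auto dest: finite_subset)
  obtain K :: "'o \<Rightarrow> ('t option \<Rightarrow> real) pmf" where K_props: "repr_info P K W = 0"
    "ent (map_pmf T' P) - I' - (log 2 (I' + 5.51) + 1.06) \<le> repr_info P K T'"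
    by (rule strong_functional_representation_finite[OF finite_T', where W = W, folded I'_def]) (rule that)
  have "I' = mut_info (map_pmf (apsnd (truncate G)) (map_pmf (\<lambda>\<omega>. (W \<omega>, T \<omega>)) P))"
    by (simp add: I'_def T'_def map_pmf_comp)
  also have "\<dots> \<le> I"
    unfolding I_def by (rule mut_info_map_snd_le) (simp add: map_pmf_comp finite_ent_T)
  finally have "I' \<le> I" .
  moreover have "0 \<le> I'"
    unfolding I'_def using finite_T'
    by (intro mut_info_nonneg finite_ent_if_finite_support) (simp add: map_pmf_comp)
  ultimately have "log 2 (I' + 5.51) \<le> log 2 (I + 5.51)"
    by (subst log_le_cancel_iff) auto
  moreover have "repr_info P K T' \<le> repr_info P K T"
    unfolding T'_def by (rule repr_info_comp_le[OF finite_ent_T])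
  moreover have "ent (map_pmf T P) - e \<le> ent (map_pmf T' P)"
    using ent_truncated by (simp add: map_pmf_comp T'_def[abs_def])
  ultimately have "ent (map_pmf T P) - I - (log 2 (I + 5.51) + 1.06) - e \<le> repr_info P K T"
    using K_props(2) \<open>I' \<le> I\<close> by linarith
  with K_props(1) show ?thesis
    by (rule that)
qed

section \<open>The privacy-utility trade-off\<close>

definition achievable :: "('s \<times> 'x \<times> 't) pmf \<Rightarrow> real \<Rightarrow> real \<Rightarrow> bool" where
  "achievable P r v \<longleftrightarrow> (\<exists>K :: 's \<times> 'x \<times> 't \<Rightarrow> nat pmf. repr_info P K (\<lambda>(s, x, t). s) = 0 \<and>
    repr_info P K (\<lambda>(s, x, t). x) \<le> r \<and> v \<le> repr_info P K (\<lambda>(s, x, t). t))"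

lemma achievableI:
  fixes K :: "'s \<times> 'x \<times> 't \<Rightarrow> 'y pmf"
  assumes "repr_info P K (\<lambda>(s, x, t). s) = 0" "repr_info P K (\<lambda>(s, x, t). x) \<le> r"
    "v \<le> repr_info P K (\<lambda>(s, x, t). t)"
  shows "achievable P r v"
proof -
  define e where "e = to_nat_on (set_pmf (bind_pmf P K))"
  have "inj_on e (set_pmf (bind_pmf P K))"
    unfolding e_def by (rule inj_on_to_nat_on) (rule countable_set_pmf)
  note same_info = repr_info_map_kernel_inj[OF this]
  show ?thesis
    unfolding achievable_def
    by (rule exI[of _ "\<lambda>\<omega>. map_pmf e (K \<omega>)"]) (simp only: same_info assms simp_thms)
qed

lemma achievable_mono: "achievable P r v \<Longrightarrow> r \<le> r' \<Longrightarrow> v' \<le> v \<Longrightarrow> achievable P r' v'"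
  unfolding achievable_def by (meson order_trans)

lemma achievable_time_sharing:
  fixes P :: "('s \<times> 'x \<times> 't) pmf"
  assumes finite_ents: "finite_ent (map_pmf (\<lambda>(s, x, t). s) P)" "finite_ent (map_pmf (\<lambda>(s, x, t). x) P)"
    "finite_ent (map_pmf (\<lambda>(s, x, t). t) P)"
    and "achievable P r1 v1" "achievable P r0 v0" and weight_bounds: "0 \<le> \<alpha>" "\<alpha> \<le> 1"
  shows "achievable P (\<alpha> * r1 + (1 - \<alpha>) * r0) (\<alpha> * v1 + (1 - \<alpha>) * v0)"
proof -
  obtain K1 K0 :: "'s \<times> 'x \<times> 't \<Rightarrow> nat pmf" where
    K1_achieves: "repr_info P K1 (\<lambda>(s, x, t). s) = 0" "repr_info P K1 (\<lambda>(s, x, t). x) \<le> r1"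
      "v1 \<le> repr_info P K1 (\<lambda>(s, x, t). t)" and
    K0_achieves: "repr_info P K0 (\<lambda>(s, x, t). s) = 0" "repr_info P K0 (\<lambda>(s, x, t). x) \<le> r0"
      "v0 \<le> repr_info P K0 (\<lambda>(s, x, t). t)"
    using assms(4,5) unfolding achievable_def by blast
  define K where "K \<omega> = bind_pmf (bernoulli_pmf \<alpha>) (\<lambda>b. map_pmf (Pair b) ((if b then K1 else K0) \<omega>))" for \<omega>
  have mixture: "repr_info P K f = \<alpha> * repr_info P K1 f + (1 - \<alpha>) * repr_info P K0 f"
    if "finite_ent (map_pmf f P)" for f :: "'s \<times> 'x \<times> 't \<Rightarrow> 'c"
    unfolding K_def using weight_bounds that by (subst repr_info_mixture) simp_all
  show ?thesis
  proof (rule achievableI)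
    show "repr_info P K (\<lambda>(s, x, t). s) = 0"
      using K1_achieves K0_achieves by (simp add: mixture finite_ents)
    show "repr_info P K (\<lambda>(s, x, t). x) \<le> \<alpha> * r1 + (1 - \<alpha>) * r0"
      unfolding mixture[OF finite_ents(2)] using K1_achieves K0_achieves weight_bounds
      by (intro add_mono mult_left_mono) auto
    show "\<alpha> * v1 + (1 - \<alpha>) * v0 \<le> repr_info P K (\<lambda>(s, x, t). t)"
      unfolding mixture[OF finite_ents(3)] using K1_achieves K0_achieves weight_bounds
      by (intro add_mono mult_left_mono) auto
  qed
qed

lemma mut_info_joint_Y:
  "mut_info (map_pmf (\<lambda>(s, x, t, y). (y, t)) (joint_Y P K)) = repr_info P K (\<lambda>(s, x, t). t)"
  "mut_info (map_pmf (\<lambda>(s, x, t, y). (y, s)) (joint_Y P K)) = repr_info P K (\<lambda>(s, x, t). s)"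
  "mut_info (map_pmf (\<lambda>(s, x, t, y). (x, y)) (joint_Y P K)) = repr_info P K (\<lambda>(s, x, t). x)"
proof -
  have laws: "map_pmf (\<lambda>(s, x, t, y). (y, t)) (joint_Y P K) = repr_law P K (\<lambda>(s, x, t). t)"
    "map_pmf (\<lambda>(s, x, t, y). (y, s)) (joint_Y P K) = repr_law P K (\<lambda>(s, x, t). s)"
    "map_pmf (\<lambda>(s, x, t, y). (x, y)) (joint_Y P K) = map_pmf prod.swap (repr_law P K (\<lambda>(s, x, t). x))"
    by (simp_all add: joint_Y_def repr_law_def map_bind_pmf map_pmf_comp case_prod_unfold)
  show "mut_info (map_pmf (\<lambda>(s, x, t, y). (y, t)) (joint_Y P K)) = repr_info P K (\<lambda>(s, x, t). t)"
    "mut_info (map_pmf (\<lambda>(s, x, t, y). (y, s)) (joint_Y P K)) = repr_info P K (\<lambda>(s, x, t). s)"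
    "mut_info (map_pmf (\<lambda>(s, x, t, y). (x, y)) (joint_Y P K)) = repr_info P K (\<lambda>(s, x, t). x)"
    unfolding laws mut_info_swap repr_info_def by (rule refl)+
qed

lemma g0_eq_Sup_repr_info:
  "g0 P r = Sup {repr_info P K (\<lambda>(s, x, t). t) | K :: _ \<Rightarrow> nat pmf.
    repr_info P K (\<lambda>(s, x, t). s) = 0 \<and> repr_info P K (\<lambda>(s, x, t). x) \<le> r}"
  unfolding g0_def mut_info_joint_Y ..

lemma U0_eq_level_integral:
  "U0 P = ent (map_pmf (\<lambda>(s, x, t). t) P) + (\<Sum>\<^sub>\<infinity>t. level_integral xlog (map_pmf fst P) (\<lambda>s. condT P s t))"
  unfolding U0_def level_integral_def xlog_def ..

lemma log_time_sharing_le: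
  fixes u v c \<alpha> :: real
  assumes "0 \<le> u" "0 \<le> v" "1 \<le> c" "0 \<le> \<alpha>" "\<alpha> \<le> 1"
  shows "(1 - \<alpha>) * log 2 (u + c) \<le> log 2 ((1 - \<alpha>) * u + \<alpha> * v + c)"
proof -
  have "- log 2 ((1 - \<alpha>) * (u + c) + \<alpha> * (v + c)) \<le> (1 - \<alpha>) * - log 2 (u + c) + \<alpha> * - log 2 (v + c)"
    using convex_onD[OF minus_log_convex[of 2], of \<alpha> "u + c" "v + c"] assms by simp
  moreover have "0 \<le> \<alpha> * log 2 (v + c)"
    using assms by simp
  moreover have "(1 - \<alpha>) * (u + c) + \<alpha> * (v + c) = (1 - \<alpha>) * u + \<alpha> * v + c"
    by (simp add: algebra_simps)
  ultimately show ?thesis by simp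
qed

locale privacy_source =
  fixes P :: "('s::finite \<times> 'x \<times> 't) pmf"
  assumes finite_ent_X: "finite_ent (map_pmf (\<lambda>(s, x, t). x) P)"
    and finite_ent_T: "finite_ent (map_pmf (\<lambda>(s, x, t). t) P)"
begin

abbreviation "H_T \<equiv> ent (map_pmf (\<lambda>(s, x, t). t) P)"
abbreviation "H_S \<equiv> ent (map_pmf (\<lambda>(s, x, t). s) P)"
abbreviation "H_XS \<equiv> ent (map_pmf (\<lambda>(s, x, t). (x, s)) P)"
abbreviation "H_X_given_S \<equiv> cond_ent (map_pmf (\<lambda>(s, x, t). (x, s)) P)"
abbreviation "H_T_given_X \<equiv> cond_ent (map_pmf (\<lambda>(s, x, t). (t, x)) P)"
abbreviation "H_T_given_S \<equiv> cond_ent (map_pmf (\<lambda>(s, x, t). (t, s)) P)"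
abbreviation "H_S_given_T \<equiv> cond_ent (map_pmf (\<lambda>(s, x, t). (s, t)) P)"
abbreviation "H_T_given_XS \<equiv> cond_ent (map_pmf (\<lambda>(s, x, t). (t, (x, s))) P)"
abbreviation "H_XS_given_T \<equiv> cond_ent (map_pmf (\<lambda>(s, x, t). ((x, s), t)) P)"
abbreviation "I_XS_T \<equiv> mut_info (map_pmf (\<lambda>(s, x, t). ((x, s), t)) P)"

lemma finite_ent_S: "finite_ent (map_pmf (\<lambda>(s, x, t). s) P)"
  by (rule finite_ent_if_finite_support) (rule finite)

lemma finite_ent_XS: "finite_ent (map_pmf (\<lambda>(s, x, t). (x, s)) P)"
  by (rule finite_ent_joint) (use finite_ent_X finite_ent_S in \<open>simp_all add: map_pmf_comp case_prod_unfold\<close>)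

lemma H_X_given_S_eq: "H_X_given_S = H_XS - H_S"
  by (simp add: cond_ent_def map_pmf_comp case_prod_unfold)

lemma H_X_given_S_nonneg: "0 \<le> H_X_given_S"
  using ent_map_le[OF finite_ent_XS, of snd] by (simp add: cond_ent_def)

lemma I_XS_T_nonneg: "0 \<le> I_XS_T"
  by (rule mut_info_nonneg) (use finite_ent_T in \<open>simp add: map_pmf_comp case_prod_unfold\<close>)

lemma H_XS_given_T_eq: "H_XS_given_T = H_XS - I_XS_T"
  using mut_info_eq_ent[of "map_pmf (\<lambda>(s, x, t). ((x, s), t)) P"] finite_ent_XS finite_ent_T
  by (simp add: cond_ent_def map_pmf_comp case_prod_unfold)

lemma H_T_given_XS_eq: "H_T_given_XS = H_T - I_XS_T"
  using cond_ent_swap[where A = "\<lambda>(s, x, t). t" and B = "\<lambda>(s, x, t). (x, s)" and P = P] H_XS_given_T_eq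
  by (simp add: case_prod_unfold)

lemma H_T_given_S_minus_H_S_given_T: "H_T_given_S - H_S_given_T = H_T - H_S"
  using cond_ent_swap[where A = "\<lambda>(s, x, t). t" and B = "\<lambda>(s, x, t). s" and P = P]
  by (simp add: case_prod_unfold)

lemma repr_info_T_le_U0:
  assumes "repr_info P K (\<lambda>(s, x, t). s) = 0"
  shows "repr_info P K (\<lambda>(s, x, t). t) \<le> U0 P"
proof -
  let ?S = "\<lambda>(s :: 's, x :: 'x, t :: 't). s" and ?T = "\<lambda>(s :: 's, x :: 'x, t :: 't). t"
  have "repr_info P K ?T \<le> H_T + (\<Sum>\<^sub>\<infinity>t. level_integral xlog (map_pmf ?S P)
      (\<lambda>s. pmf (map_pmf (\<lambda>\<omega>. (?S \<omega>, ?T \<omega>)) P) (s, t) / pmf (map_pmf ?S P) s))"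
    by (rule repr_info_le_level_integral[OF finite finite_ent_T assms])
  also have "\<dots> = U0 P"
    unfolding U0_eq_level_integral condT_def case_prod_unfold ..
  finally show ?thesis .
qed

lemma repr_info_T_le:
  assumes S_private: "repr_info P K (\<lambda>(s, x, t). s) = 0" and X_bounded: "repr_info P K (\<lambda>(s, x, t). x) \<le> r"
  shows "repr_info P K (\<lambda>(s, x, t). t) \<le> min (H_T_given_X + r) (min H_T_given_S (U0 P))"
  using repr_info_le_add_cond_ent[OF finite_ent_X finite_ent_T, of K]
    repr_info_le_add_cond_ent[OF finite_ent_S finite_ent_T, of K]
    repr_info_T_le_U0[OF S_private] S_private X_bounded
  by (simp add: case_prod_unfold)

lemma g0_ge:
  assumes "\<And>e. 0 < e \<Longrightarrow> achievable P r (v - e)"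
  shows "v \<le> g0 P r"
proof (rule field_le_epsilon)
  fix e :: real assume "0 < e"
  from assms[OF this] obtain K :: "_ \<Rightarrow> nat pmf" where K_achieves: "repr_info P K (\<lambda>(s, x, t). s) = 0"
    "repr_info P K (\<lambda>(s, x, t). x) \<le> r" "v - e \<le> repr_info P K (\<lambda>(s, x, t). t)"
    unfolding achievable_def by blast
  have "repr_info P K (\<lambda>(s, x, t). t) \<le> g0 P r"
    unfolding g0_eq_Sup_repr_info
  proof (rule cSup_upper)
    show "bdd_above {repr_info P K (\<lambda>(s, x, t). t) | K :: _ \<Rightarrow> nat pmf.
        repr_info P K (\<lambda>(s, x, t). s) = 0 \<and> repr_info P K (\<lambda>(s, x, t). x) \<le> r}"
      by (rule bdd_aboveI[of _ "U0 P"]) (auto intro: repr_info_T_le_U0)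
  qed (use K_achieves in blast)
  with K_achieves show "v \<le> g0 P r + e" by simp
qed

lemma achievable_functional_S:
  assumes "0 < e"
  shows "achievable P H_X_given_S (H_T - H_S - e)"
proof -
  obtain K :: "_ \<Rightarrow> ('s \<Rightarrow> 't) pmf" where K_props: "repr_info P K (\<lambda>(s, x, t). s) = 0"
    "H_T - H_S - e \<le> repr_info P K (\<lambda>(s, x, t). t)"
    using functional_representation[OF finite_ent_S finite_ent_T assms] .
  moreover have "repr_info P K (\<lambda>(s, x, t). x) \<le> H_X_given_S"
    using repr_info_le_add_cond_ent[OF finite_ent_S finite_ent_X, of K] K_props(1)
    by (simp add: case_prod_unfold)
  ultimately show ?thesis
    by (intro achievableI)
qed

lemma achievable_0:
  assumes "repr_info P K (\<lambda>(s, x, t). (x, s)) = 0" "v \<le> repr_info P K (\<lambda>(s, x, t). t)"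
  shows "achievable P 0 v"
  using repr_info_comp_eq_0[OF finite_ent_XS assms(1), of snd]
    repr_info_comp_eq_0[OF finite_ent_XS assms(1), of fst] assms(2)
  by (intro achievableI) (simp_all add: case_prod_unfold)

lemma achievable_functional_XS:
  assumes "0 < e"
  shows "achievable P 0 (H_T - H_XS - e)"
proof -
  obtain K :: "_ \<Rightarrow> ('x \<times> 's \<Rightarrow> 't) pmf" where "repr_info P K (\<lambda>(s, x, t). (x, s)) = 0"
    "H_T - H_XS - e \<le> repr_info P K (\<lambda>(s, x, t). t)"
    using functional_representation[OF finite_ent_XS finite_ent_T assms] .
  then show ?thesis
    by (rule achievable_0)
qed

lemma achievable_strong_functional_XS:
  assumes "0 < e"
  shows "achievable P 0 (H_T - I_XS_T - (log 2 (I_XS_T + 5.51) + 1.06) - e)"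
proof -
  have law: "map_pmf (\<lambda>\<omega>. (case \<omega> of (s, x, t) \<Rightarrow> (x, s), case \<omega> of (s, x, t) \<Rightarrow> t)) P
      = map_pmf (\<lambda>(s, x, t). ((x, s), t)) P"
    by (simp add: case_prod_unfold)
  obtain K :: "_ \<Rightarrow> ('t option \<Rightarrow> real) pmf" where "repr_info P K (\<lambda>(s, x, t). (x, s)) = 0"
    "H_T - I_XS_T - (log 2 (I_XS_T + 5.51) + 1.06) - e \<le> repr_info P K (\<lambda>(s, x, t). t)"
    using strong_functional_representation[where W = "\<lambda>(s, x, t). (x, s)", OF finite_ent_T assms, unfolded law] .
  then show ?thesis
    by (rule achievable_0)
qed

lemma achievable_interpolation:
  assumes r_bounds: "0 \<le> r" "r \<le> H_X_given_S" and "0 < e" and zero_rate: "achievable P 0 v"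
  defines "\<alpha> \<equiv> r / H_X_given_S"
  shows "achievable P r (\<alpha> * (H_T - H_S - e) + (1 - \<alpha>) * v)"
proof -
  have "0 \<le> \<alpha>" "\<alpha> \<le> 1" "\<alpha> * H_X_given_S = r"
    using r_bounds by (auto simp: \<alpha>_def divide_le_eq_1)
  then show ?thesis
    using achievable_time_sharing[OF finite_ent_S finite_ent_X finite_ent_T
        achievable_functional_S[OF \<open>0 < e\<close>] zero_rate, of \<alpha>] by simp
qed

lemma g0_ge_functional:
  assumes r_bounds: "0 \<le> r" "r \<le> H_X_given_S"
  shows "H_T_given_XS + r - H_XS_given_T \<le> g0 P r"
proof (rule g0_ge)
  fix e :: real assume e_pos: "0 < e"
  define \<alpha> where "\<alpha> = r / H_X_given_S"
  have "\<alpha> * (H_XS - H_S) = r"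
    using r_bounds by (auto simp: \<alpha>_def simp flip: H_X_given_S_eq)
  then have "\<alpha> * (H_T - H_S - e) + (1 - \<alpha>) * (H_T - H_XS - e) = H_T_given_XS + r - H_XS_given_T - e"
    unfolding H_T_given_XS_eq H_XS_given_T_eq by (simp add: algebra_simps)
  then show "achievable P r (H_T_given_XS + r - H_XS_given_T - e)"
    using achievable_interpolation[OF r_bounds e_pos achievable_functional_XS[OF e_pos]] by (simp add: \<alpha>_def)
qed

lemma g0_ge_functional_S:
  assumes "H_X_given_S \<le> r"
  shows "H_T_given_S - H_S_given_T \<le> g0 P r"
proof (rule g0_ge)
  fix e :: real assume "0 < e"
  from achievable_functional_S[OF this] assms show "achievable P r (H_T_given_S - H_S_given_T - e)"
    by (rule achievable_mono) (simp add: H_T_given_S_minus_H_S_given_T)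
qed

lemma g0_ge_strong_functional:
  assumes "0 \<le> r"
  shows "H_T_given_XS - (log 2 (I_XS_T + 5.51) + 1.06) \<le> g0 P r"
proof (rule g0_ge)
  fix e :: real assume "0 < e"
  from achievable_strong_functional_XS[OF this] assms
  show "achievable P r (H_T_given_XS - (log 2 (I_XS_T + 5.51) + 1.06) - e)"
    by (rule achievable_mono) (simp add: H_T_given_XS_eq)
qed

lemma g0_ge_time_shared_strong_functional:
  assumes r_bounds: "0 \<le> r" "r \<le> H_X_given_S"
  defines "\<alpha> \<equiv> r / H_X_given_S"
  shows "H_T_given_XS + r - \<alpha> * H_XS_given_T - 1.06
      - log 2 ((1 - \<alpha>) * I_XS_T + \<alpha> * min H_T H_XS + 5.51) \<le> g0 P r" (is "?L \<le> _")
proof (rule g0_ge)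
  fix e :: real assume e_pos: "0 < e"
  define l where "l = log 2 (I_XS_T + 5.51)"
  have weight_bounds: "0 \<le> \<alpha>" "\<alpha> \<le> 1"
    using r_bounds by (auto simp: \<alpha>_def divide_le_eq_1)
  have scaled_log: "(1 - \<alpha>) * l \<le> log 2 ((1 - \<alpha>) * I_XS_T + \<alpha> * min H_T H_XS + 5.51)"
    unfolding l_def by (rule log_time_sharing_le) (simp_all add: I_XS_T_nonneg ent_nonneg weight_bounds)
  have scaled_const: "(1 - \<alpha>) * 1.06 \<le> 1.06"
    using weight_bounds by simp
  have "\<alpha> * (H_XS - H_S) = r"
    using r_bounds by (auto simp: \<alpha>_def simp flip: H_X_given_S_eq)
  then have shared: "\<alpha> * (H_T - H_S - e) + (1 - \<alpha>) * (H_T - I_XS_T - (l + 1.06) - e)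
      = H_T_given_XS + r - \<alpha> * H_XS_given_T - (1 - \<alpha>) * 1.06 - (1 - \<alpha>) * l - e"
    unfolding H_T_given_XS_eq H_XS_given_T_eq by (simp add: algebra_simps)
  have "?L - e \<le> \<alpha> * (H_T - H_S - e) + (1 - \<alpha>) * (H_T - I_XS_T - (l + 1.06) - e)"
    unfolding shared by (intro diff_mono order.refl scaled_log scaled_const)
  then show "achievable P r (?L - e)"
    using achievable_mono[OF achievable_interpolation[OF r_bounds e_pos achievable_strong_functional_XS[OF e_pos]]
        order.refl]
    by (simp add: \<alpha>_def l_def)
qed

lemma g0_le:
  assumes "0 \<le> r"
  shows "g0 P r \<le> min (H_T_given_X + r) (min H_T_given_S (U0 P))"
  unfolding g0_eq_Sup_repr_info
proof (rule cSup_least)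
  have "achievable P r (H_T - H_XS - 1)"
    using achievable_functional_XS[of 1] assms by (rule achievable_mono) simp_all
  then show "{repr_info P K (\<lambda>(s, x, t). t) | K :: _ \<Rightarrow> nat pmf.
      repr_info P K (\<lambda>(s, x, t). s) = 0 \<and> repr_info P K (\<lambda>(s, x, t). x) \<le> r} \<noteq> {}"
    by (auto simp: achievable_def)
qed (use repr_info_T_le in blast)

end

theorem theorem1:
  fixes P :: "('s::finite \<times> 'x::countable \<times> 't::countable) pmf" and r :: real
  assumes "finite_ent (map_pmf (\<lambda>(s,x,t). x) P)"
      and "finite_ent (map_pmf (\<lambda>(s,x,t). t) P)"
  defines "HT \<equiv> ent (map_pmf (\<lambda>(s,x,t). t) P)"
      and "HX \<equiv> ent (map_pmf (\<lambda>(s,x,t). x) P)"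
      and "HS \<equiv> ent (map_pmf (\<lambda>(s,x,t). s) P)"
      and "HXS \<equiv> ent (map_pmf (\<lambda>(s,x,t). (x,s)) P)"
      and "HX_S \<equiv> cond_ent (map_pmf (\<lambda>(s,x,t). (x,s)) P)"
      and "HT_X \<equiv> cond_ent (map_pmf (\<lambda>(s,x,t). (t,x)) P)"
      and "HT_S \<equiv> cond_ent (map_pmf (\<lambda>(s,x,t). (t,s)) P)"
      and "HS_T \<equiv> cond_ent (map_pmf (\<lambda>(s,x,t). (s,t)) P)"
      and "HT_XS \<equiv> cond_ent (map_pmf (\<lambda>(s,x,t). (t,(x,s))) P)"
      and "HXS_T \<equiv> cond_ent (map_pmf (\<lambda>(s,x,t). ((x,s),t)) P)"
      and "IXST \<equiv> mut_info (map_pmf (\<lambda>(s,x,t). ((x,s),t)) P)"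
  shows "(0 \<le> r \<and> r \<le> HX_S \<longrightarrow>
           (let \<alpha> = r / HX_S;
                L1 = HT_XS + r - HXS_T;
                L2 = HT_XS - (log 2 (IXST + 5.51) + 1.06);
                L3 = HT_XS + r - \<alpha> * HXS_T - 1.06
                     - log 2 ((1 - \<alpha>) * IXST + \<alpha> * min HT HXS + 5.51)
            in max L1 (max L2 L3) \<le> g0 P r \<and>
               g0 P r \<le> min (HT_X + r) (min HT_S (U0 P))))
       \<and> (HX_S \<le> r \<and> r < HX \<longrightarrow>
           (let L1' = HT_S - HS_T;
                L2 = HT_XS - (log 2 (IXST + 5.51) + 1.06)
            in max L1' L2 \<le> g0 P r \<and>
               g0 P r \<le> min (HT_X + r) (min HT_S (U0 P))))"
proof -
  interpret privacy_source P
    using assms(1,2) by unfold_locales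
  show ?thesis
    unfolding assms Let_def max.bounded_iff
    using g0_ge_functional[of r] g0_ge_functional_S[of r] g0_ge_strong_functional[of r]
      g0_ge_time_shared_strong_functional[of r] g0_le[of r] H_X_given_S_nonneg
    by (meson order_trans)
qed

end
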